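(* Let $k$ be a field, let $X = \{f = 0\} \subset \mathbb{P}_k(a_0,\ldots,a_{n+1})$ be an irreducible weighted projective hypersurface over $k$, and let $1 \leq m \leq n-1$ be an integer with the following properties: (1) $\gcd\{a_0,\ldots,a_m\} = 1$ and the set $\{a_{m+1},\ldots,a_{n+1}\}$ is well-formed; (2) every monomial of $f$ has degree $1$ or $2$ in the variables $x_0,\ldots,x_m$, and at least one monomial of $f$ has degree $1$ in these variables. Then $X$ is rational over $k$.
   Context: For positive integers $a_0,\ldots,a_{n+1}$, the weighted projective space is $\mathbb{P}_k(a_0,\ldots,a_{n+1}) = \mathrm{Proj}(k[x_0,\ldots,x_{n+1}])$, where $x_i$ has weight $a_i$. A weighted projective hypersurface is a subvariety defined by a single polynomial $f(x_0,\ldots,x_{n+1})$ with coefficients in $k$ that is weighted homogeneous of some degree $d$. A set (with repetitions allowed) $\{c_1,\ldots,c_r\}$ of integers is well-formed if $\gcd(c_1,\ldots,\widehat{c_i},\ldots,c_r) = 1$ for each $i = 1,\ldots,r$ (the hat denotes omission). The monomials of $f$ are those appearing with nonzero coefficient; the degree of a monomial $\prod_j x_j^{e_j}$ in the variables $x_0,\ldots,x_m$ is the ordinary (unweighted) degree $e_0+\cdots+e_m$. An irreducible variety $X$ over $k$ is rational over $k$ if there is a birational map $X \dashrightarrow \mathbb{P}^{\dim X}_k$ defined over $k$. *)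

theory Defs
  imports "HOL-Library.Poly_Mapping" "HOL-Algebra.Ideal"
begin

section \<open>Weighted graded polynomial rings\<close>

text \<open>
  A monomial is a finitely supported exponent vector. The ring \<open>k[x_0, ..., x_(N-1)]\<close> is the
  subring \<open>polys N\<close> of the ring of polynomials in the variables \<open>x_0, x_1, ...\<close>.
\<close>

type_synonym monomial = "nat \<Rightarrow>\<^sub>0 nat"

type_synonym 'k mpoly = "(nat \<Rightarrow>\<^sub>0 nat) \<Rightarrow>\<^sub>0 'k"

definition Const :: "'k::field \<Rightarrow> 'k mpoly" where
  "Const c = Poly_Mapping.single 0 c"

definition Var :: "nat \<Rightarrow> 'k::field mpoly" where
  "Var i = Poly_Mapping.single (Poly_Mapping.single i 1) 1"

definition polys :: "nat \<Rightarrow> 'k::field mpoly set" where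
  "polys N = {p. \<forall>u \<in> Poly_Mapping.keys p. Poly_Mapping.keys u \<subseteq> {..<N}}"

definition poly_ring :: "nat \<Rightarrow> 'k::field mpoly ring" where
  "poly_ring N = \<lparr>carrier = polys N, monoid.mult = (*), one = 1, zero = 0, add = (+)\<rparr>"

definition weighted_degree :: "(nat \<Rightarrow> nat) \<Rightarrow> monomial \<Rightarrow> nat" where
  "weighted_degree a u = (\<Sum>i \<in> Poly_Mapping.keys u. a i * Poly_Mapping.lookup u i)"

definition degree_in :: "nat set \<Rightarrow> monomial \<Rightarrow> nat" where
  "degree_in I u = (\<Sum>i \<in> I. Poly_Mapping.lookup u i)"

text \<open>The zero polynomial is weighted homogeneous of every degree.\<close>

definition weighted_homogeneous :: "(nat \<Rightarrow> nat) \<Rightarrow> nat \<Rightarrow> 'k::field mpoly \<Rightarrow> bool" where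
  "weighted_homogeneous a d p \<longleftrightarrow> (\<forall>u \<in> Poly_Mapping.keys p. weighted_degree a u = d)"

definition homogeneous_component ::
    "(nat \<Rightarrow> nat) \<Rightarrow> nat \<Rightarrow> 'k::field mpoly \<Rightarrow> 'k mpoly" where
  "homogeneous_component a d p =
     (\<Sum>u \<in> {u \<in> Poly_Mapping.keys p. weighted_degree a u = d}.
        Poly_Mapping.single u (Poly_Mapping.lookup p u))"

definition subst :: "(nat \<Rightarrow> 'k::field mpoly) \<Rightarrow> 'k mpoly \<Rightarrow> 'k mpoly" where
  "subst h p =
     (\<Sum>u \<in> Poly_Mapping.keys p.
        Const (Poly_Mapping.lookup p u) *
        (\<Prod>i \<in> Poly_Mapping.keys u. h i ^ Poly_Mapping.lookup u i))"

lemma polys_closed: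
  fixes p q :: "'k::field mpoly"
  shows "0 \<in> polys N" "1 \<in> polys N"
    and "p \<in> polys N \<Longrightarrow> q \<in> polys N \<Longrightarrow> p + q \<in> polys N"
    and "p \<in> polys N \<Longrightarrow> - p \<in> polys N"
    and "p \<in> polys N \<Longrightarrow> q \<in> polys N \<Longrightarrow> p * q \<in> polys N"
proof -
  show "0 \<in> polys N" "1 \<in> polys N"
    by (auto simp: polys_def)
  show "p \<in> polys N \<Longrightarrow> q \<in> polys N \<Longrightarrow> p + q \<in> polys N"
    using Poly_Mapping.keys_add[of p q] by (fastforce simp: polys_def)
  show "p \<in> polys N \<Longrightarrow> - p \<in> polys N"
    by (simp add: polys_def)
  show "p * q \<in> polys N" if "p \<in> polys N" "q \<in> polys N"
    unfolding polys_def
  proof (clarify)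
    fix u i assume "u \<in> Poly_Mapping.keys (p * q)" "i \<in> Poly_Mapping.keys u"
    moreover from this obtain v w where "u = v + w" "v \<in> Poly_Mapping.keys p"
      "w \<in> Poly_Mapping.keys q"
      using keys_mult[of p q] by blast
    ultimately show "i < N"
      using that Poly_Mapping.keys_add[of v w] by (fastforce simp: polys_def)
  qed
qed

lemma cring_poly_ring: "cring (poly_ring N :: 'k::field mpoly ring)"
proof (rule cringI)
  show "abelian_group (poly_ring N :: 'k mpoly ring)"
  proof (rule abelian_groupI)
    show "\<exists>y \<in> carrier (poly_ring N). y \<oplus>\<^bsub>poly_ring N\<^esub> x = \<zero>\<^bsub>poly_ring N\<^esub>"
      if "x \<in> carrier (poly_ring N)" for x :: "'k mpoly"
      using that by (intro bexI[of _ "- x"]) (auto simp: poly_ring_def polys_closed)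
  qed (auto simp: poly_ring_def polys_closed algebra_simps)
  show "Group.comm_monoid (poly_ring N :: 'k mpoly ring)"
    by (rule comm_monoidI) (auto simp: poly_ring_def polys_closed algebra_simps)
qed (auto simp: poly_ring_def algebra_simps)


section \<open>Weighted projective spaces and their closed subsets\<close>

text \<open>
  \<open>Proj k[x_0, ..., x_(N-1)]\<close> is the set of homogeneous prime ideals not containing the
  irrelevant ideal. For positive weights, the irrelevant ideal is generated by the variables.
\<close>

definition homogeneous_ideal :: "(nat \<Rightarrow> nat) \<Rightarrow> 'k::field mpoly set \<Rightarrow> bool" where
  "homogeneous_ideal a P \<longleftrightarrow> (\<forall>p \<in> P. \<forall>d. homogeneous_component a d p \<in> P)"

definition Proj :: "nat \<Rightarrow> (nat \<Rightarrow> nat) \<Rightarrow> 'k::field mpoly set set" where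
  "Proj N a =
     {P. primeideal P (poly_ring N) \<and> homogeneous_ideal a P \<and> \<not> Var ` {..<N} \<subseteq> P}"

definition zero_locus :: "nat \<Rightarrow> (nat \<Rightarrow> nat) \<Rightarrow> 'k::field mpoly set \<Rightarrow> 'k mpoly set set" where
  "zero_locus N a F = {P \<in> Proj N a. F \<subseteq> P}"

definition zariski_closed :: "nat \<Rightarrow> (nat \<Rightarrow> nat) \<Rightarrow> 'k::field mpoly set set \<Rightarrow> bool" where
  "zariski_closed N a C \<longleftrightarrow>
     (\<exists>F \<subseteq> polys N. (\<forall>p \<in> F. \<exists>d. weighted_homogeneous a d p) \<and> C = zero_locus N a F)"

text \<open>
  A set of points of \<open>Proj\<close> together with the ambient space: \<open>ncoords\<close> homogeneous coordinates
  \<open>x_0, x_1, ...\<close> of the given weights. A closed set of points is understood with its reduced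
  structure, that is, as defined by its vanishing ideal.
\<close>

record (overloaded) 'k projective_set =
  ncoords :: nat
  weight :: "nat \<Rightarrow> nat"
  points :: "'k mpoly set set"

definition weighted_projective_space :: "nat \<Rightarrow> (nat \<Rightarrow> nat) \<Rightarrow> 'k::field projective_set" where
  "weighted_projective_space N a = \<lparr>ncoords = N, weight = a, points = Proj N a\<rparr>"

definition projective_space :: "nat \<Rightarrow> 'k::field projective_set" where
  "projective_space r = weighted_projective_space (r + 1) (\<lambda>_. 1)"

definition hypersurface :: "nat \<Rightarrow> (nat \<Rightarrow> nat) \<Rightarrow> 'k::field mpoly \<Rightarrow> 'k projective_set" where
  "hypersurface N a f = \<lparr>ncoords = N, weight = a, points = zero_locus N a {f}\<rparr>"

definition irreducible_set :: "'k::field projective_set \<Rightarrow> bool" where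
  "irreducible_set X \<longleftrightarrow>
     points X \<noteq> {} \<and>
     (\<forall>A B. zariski_closed (ncoords X) (weight X) A \<and> zariski_closed (ncoords X) (weight X) B \<and>
        points X \<subseteq> A \<union> B \<longrightarrow> points X \<subseteq> A \<or> points X \<subseteq> B)"

definition vanishing_ideal :: "'k::field projective_set \<Rightarrow> 'k mpoly set" where
  "vanishing_ideal X = {p \<in> polys (ncoords X). \<forall>P \<in> points X. p \<in> P}"


section \<open>Rational and birational maps\<close>

text \<open>
  Let \<open>X\<close> and \<open>Y\<close> be irreducible closed subsets of weighted projective spaces over \<open>k\<close>, and let
  \<open>b_j\<close> be the weights of the coordinates around \<open>Y\<close>. A rational map from \<open>X\<close> to \<open>Y\<close> over \<open>k\<close>
  is written in homogeneous coordinates as \<open>(h_0 : h_1 : ...)\<close>, where \<open>h_j\<close> is a homogeneous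
  polynomial of degree \<open>e b_j\<close> in the coordinates of \<open>X\<close> (with \<open>e\<close> independent of \<open>j\<close>), not all
  \<open>h_j\<close> vanish on \<open>X\<close>, and the equations of \<open>Y\<close> hold for \<open>h\<close> on \<open>X\<close>. Every rational map has
  such a representation: it is a point of \<open>Y\<close> over the function field of \<open>X\<close>, every such point
  lifts to a nonzero vector of weighted homogeneous coordinates in this field, and denominators
  are cleared by rescaling. Vanishing on \<open>X\<close> means membership in the vanishing ideal, so the
  definition is also adequate over finite fields.
\<close>

definition rational_map ::
    "'k::field projective_set \<Rightarrow> 'k projective_set \<Rightarrow> (nat \<Rightarrow> 'k mpoly) \<Rightarrow> bool" where
  "rational_map X Y h \<longleftrightarrow>
     (\<exists>e. \<forall>j < ncoords Y.
        h j \<in> polys (ncoords X) \<and> weighted_homogeneous (weight X) (e * weight Y j) (h j)) \<and>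
     (\<exists>j < ncoords Y. h j \<notin> vanishing_ideal X) \<and>
     (\<forall>F \<in> vanishing_ideal Y. subst h F \<in> vanishing_ideal X)"

text \<open>
  Two coordinate vectors represent the same rational map iff every quotient \<open>F / G\<close> of
  homogeneous polynomials of equal degree takes the same value on both; multiplied out, this
  also forces both to satisfy the same homogeneous equations.
\<close>

definition same_rational_map ::
    "'k::field projective_set \<Rightarrow> 'k projective_set \<Rightarrow>
     (nat \<Rightarrow> 'k mpoly) \<Rightarrow> (nat \<Rightarrow> 'k mpoly) \<Rightarrow> bool" where
  "same_rational_map X Y g h \<longleftrightarrow>
     (\<forall>d. \<forall>F \<in> polys (ncoords Y). \<forall>G \<in> polys (ncoords Y).
        weighted_homogeneous (weight Y) d F \<and> weighted_homogeneous (weight Y) d G \<longrightarrow>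
        subst g F * subst h G - subst h F * subst g G \<in> vanishing_ideal X)"

definition compose_maps ::
    "(nat \<Rightarrow> 'k::field mpoly) \<Rightarrow> (nat \<Rightarrow> 'k mpoly) \<Rightarrow> nat \<Rightarrow> 'k mpoly" where
  "compose_maps \<psi> \<phi> = (\<lambda>i. subst \<phi> (\<psi> i))"

text \<open>
  The conditions \<^term>\<open>rational_map X X (compose_maps \<psi> \<phi>)\<close> and
  \<^term>\<open>rational_map Y Y (compose_maps \<phi> \<psi>)\<close> say that the composites are defined, i.e. that their
  coordinates do not all vanish identically. \<^const>\<open>Var\<close> represents the identity.
\<close>

definition birational_map ::
    "'k::field projective_set \<Rightarrow> 'k projective_set \<Rightarrow> (nat \<Rightarrow> 'k mpoly) \<Rightarrow> bool" where
  "birational_map X Y \<phi> \<longleftrightarrow>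
     rational_map X Y \<phi> \<and>
     (\<exists>\<psi>. rational_map Y X \<psi> \<and>
        rational_map X X (compose_maps \<psi> \<phi>) \<and> same_rational_map X X (compose_maps \<psi> \<phi>) Var \<and>
        rational_map Y Y (compose_maps \<phi> \<psi>) \<and> same_rational_map Y Y (compose_maps \<phi> \<psi>) Var)"

text \<open>
  Rationality of an irreducible variety \<open>X\<close> of dimension \<open>r\<close>. The dimension is a parameter; it is
  determined by \<open>X\<close>, since birational varieties have the same dimension. For a hypersurface in
  \<open>P(a_0, ..., a_(n+1))\<close> it is \<open>n\<close>.
\<close>

definition rational_variety :: "nat \<Rightarrow> 'k::field projective_set \<Rightarrow> bool" where
  "rational_variety r X \<longleftrightarrow> (\<exists>\<phi>. birational_map X (projective_space r) \<phi>)"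


section \<open>Well-formed families\<close>

text \<open>Families indexed by a set, so that repetitions are allowed.\<close>

definition well_formed :: "nat set \<Rightarrow> (nat \<Rightarrow> nat) \<Rightarrow> bool" where
  "well_formed I c \<longleftrightarrow> (\<forall>i \<in> I. Gcd (c ` (I - {i})) = 1)"

end

theory Submission
  imports Defs
begin

text \<open>
  Let \<open>S\<close> be a nonempty set of coordinates, and suppose that \<open>f = A + B\<close>, where every monomial of
  \<open>A\<close> has degree \<open>s\<close> in the coordinates of \<open>S\<close>, every monomial of \<open>B\<close> has degree \<open>s + 1\<close> in them,
  and \<open>B \<noteq> 0\<close>. If the weights outside \<open>S\<close> have greatest common divisor 1, the lattice of exponents
  of Laurent monomials has a basis consisting of exponents of monomials \<open>z_1, ..., z_n\<close> of
  weighted degree 0 and degree 0 in \<open>S\<close>, of a monomial \<open>v\<close> of weighted degree 0 and degree 1 in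
  \<open>S\<close>, and of a monomial \<open>u\<close> of weighted degree 1 and degree 0 in \<open>S\<close>. In these coordinates
  \<open>f = u^d v^s (A_0(z) + v B_0(z))\<close> is linear in \<open>v\<close>. Hence \<open>v = - A_0 / B_0\<close> on \<open>X\<close>, and
  \<open>z_1, ..., z_n\<close> are birational coordinates on \<open>X\<close>. The case \<open>A = 0\<close> is admitted only for
  \<open>S = {i}\<close> and \<open>s = 0\<close>; then \<open>X\<close> is the hyperplane \<open>x_i = 0\<close>, and the \<open>z_k\<close> are again birational
  coordinates.

  The hypotheses provide such a set \<open>S\<close>. If some monomial of \<open>f\<close> has degree 2 in \<open>x_0, ..., x_m\<close>,
  then \<open>S = {0..m}\<close> and \<open>s = 1\<close> work, and both \<open>A\<close> and \<open>B\<close> are nonzero. Otherwise \<open>f\<close> is linear in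
  \<open>x_0, ..., x_m\<close>, and \<open>S = {i}\<close> and \<open>s = 0\<close> work for each of these variables \<open>x_i\<close> that occurs in
  \<open>f\<close>. In both cases the weights outside \<open>S\<close> include \<open>a_(m+1), ..., a_(n+1)\<close>, whose greatest
  common divisor is 1 because they are well-formed.

  The function field of \<open>X\<close> is avoided. The parametrization \<open>\<psi>\<close> of \<open>X\<close> by \<open>P^n\<close> that is described
  above is a vector of polynomials, and it is a generic point: a homogeneous form \<open>F\<close> vanishes on
  \<open>X\<close> iff \<open>F(\<psi>) = 0\<close>. For such a \<open>\<psi>\<close>, a map \<open>\<phi>\<close> is an inverse on both sides as soon as \<open>\<phi> \<circ> \<psi>\<close> is
  the identity of \<open>P^n\<close>; this is \<open>rational_variety_criterion\<close>. That \<open>\<psi>\<close> is generic has two halves.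
  The forms with \<open>F(\<psi>) = 0\<close> generate a homogeneous prime ideal that contains \<open>f\<close>
  (\<open>kernel_in_Proj\<close>), that is, a point of \<open>X\<close>, so every form vanishing on \<open>X\<close> is among them; in
  particular \<open>B\<close> does not vanish identically on \<open>X\<close> when \<open>B(\<psi>) \<noteq> 0\<close>. Conversely, since
  \<open>f = A + B\<close>, a power of \<open>B\<close> times \<open>F\<close> is congruent modulo \<open>f\<close> to a form \<open>R\<close> all of whose
  monomials have the same degree in \<open>S\<close>. If \<open>A \<noteq> 0\<close>, substitution of \<open>\<psi>\<close> is injective on such
  forms, because the \<open>z_k\<close> are independent (\<open>subst_chart_nonzero\<close>); so \<open>F(\<psi>) = 0\<close> gives \<open>R = 0\<close>,
  and \<open>F\<close> vanishes on \<open>X\<close> because \<open>X\<close> is irreducible.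
\<close>

section \<open>Evaluation of polynomials\<close>

definition monomial_value :: "(nat \<Rightarrow> 'k::field mpoly) \<Rightarrow> monomial \<Rightarrow> 'k mpoly" where
  "monomial_value h u = (\<Prod>i \<in> Poly_Mapping.keys u. h i ^ Poly_Mapping.lookup u i)"

lemma monomial_value_superset:
  assumes "finite A" "Poly_Mapping.keys u \<subseteq> A"
  shows "monomial_value h u = (\<Prod>i \<in> A. h i ^ Poly_Mapping.lookup u i)"
  unfolding monomial_value_def
  by (rule prod.mono_neutral_left) (use assms in \<open>auto simp: in_keys_iff\<close>)

lemma monomial_value_add:
  "monomial_value h (u + v) = monomial_value h u * monomial_value h v"
proof -
  let ?A = "Poly_Mapping.keys u \<union> Poly_Mapping.keys v"
  have "Poly_Mapping.keys (u + v) \<subseteq> ?A" by (rule Poly_Mapping.keys_add)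
  then show ?thesis
    by (simp add: monomial_value_superset[of ?A] lookup_add power_add prod.distrib)
qed

lemma monomial_value_zero [simp]: "monomial_value h 0 = 1"
  by (simp add: monomial_value_def)

lemma monomial_value_single [simp]: "monomial_value h (Poly_Mapping.single i e) = h i ^ e"
  by (simp add: monomial_value_def)

lemma Const_add: "Const (a + b) = Const a + Const b"
  by (simp add: Const_def single_add)

lemma Const_mult: "Const (a * b) = Const a * Const b"
  by (simp add: Const_def mult_single)

lemma Const_zero [simp]: "Const 0 = 0"
  by (simp add: Const_def)

lemma subst_superset:
  assumes "finite A" "Poly_Mapping.keys p \<subseteq> A"
  shows "subst h p = (\<Sum>u \<in> A. Const (Poly_Mapping.lookup p u) * monomial_value h u)"
  unfolding subst_def monomial_value_def[symmetric]
  by (rule sum.mono_neutral_left) (use assms in \<open>auto simp: in_keys_iff\<close>)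

lemma subst_single: "subst h (Poly_Mapping.single u c) = Const c * monomial_value h u"
  by (simp add: subst_superset[of "{u}"])

lemma single_nonzero: "c \<noteq> 0 \<Longrightarrow> Poly_Mapping.single u c \<noteq> 0"
  by (metis lookup_single_eq lookup_zero)

lemma Var_nonzero [simp]: "(Var i :: 'k::field mpoly) \<noteq> 0"
  by (metis Var_def lookup_single_eq lookup_zero zero_neq_one)

lemma subst_zero [simp]: "subst h 0 = 0"
  by (simp add: subst_def)

lemma subst_one [simp]: "subst h 1 = 1"
  by (simp add: subst_def Const_def)

lemma subst_Var [simp]: "subst h (Var i) = h i"
  by (simp add: Var_def subst_single Const_def)

lemma subst_add: "subst h (p + q) = subst h p + subst h q"
proof -
  let ?A = "Poly_Mapping.keys p \<union> Poly_Mapping.keys q"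
  have "Poly_Mapping.keys (p + q) \<subseteq> ?A" by (rule Poly_Mapping.keys_add)
  then show ?thesis
    by (simp add: subst_superset[of ?A] lookup_add Const_add ring_distribs sum.distrib)
qed

lemma subst_uminus: "subst h (- p) = - subst h p"
  using subst_add[of h p "- p"] by (simp add: eq_neg_iff_add_eq_0 add.commute)

lemma subst_diff: "subst h (p - q) = subst h p - subst h q"
  using subst_add[of h p "- q"] by (simp add: subst_uminus)

lemma subst_sum: "subst h (\<Sum>x \<in> A. g x) = (\<Sum>x \<in> A. subst h (g x))"
  by (induction A rule: infinite_finite_induct) (simp_all add: subst_add)

lemma sum_of_monomials:
  "(\<Sum>u \<in> Poly_Mapping.keys p. Poly_Mapping.single u (Poly_Mapping.lookup p u)) = p"
  by (rule poly_mapping_eqI)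
     (auto simp: lookup_sum lookup_single when_def in_keys_iff if_distrib cong: if_cong)

text \<open>
  Both sides are additive in each factor, so this reduces to single monomials.
\<close>

lemma subst_mult: "subst h (p * q) = subst h p * subst h q"
proof -
  let ?s = "\<lambda>p u. Poly_Mapping.single u (Poly_Mapping.lookup p u) :: 'a mpoly"
  have single: "subst h (?s p u * ?s q v) = subst h (?s p u) * subst h (?s q v)" for u v
    by (simp add: mult_single subst_single Const_mult monomial_value_add)
  have "subst h ((\<Sum>u \<in> Poly_Mapping.keys p. ?s p u) * (\<Sum>v \<in> Poly_Mapping.keys q. ?s q v)) =
    subst h (\<Sum>u \<in> Poly_Mapping.keys p. ?s p u) * subst h (\<Sum>v \<in> Poly_Mapping.keys q. ?s q v)"
    by (simp add: sum_product subst_sum single)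
  then show ?thesis by (simp add: sum_of_monomials)
qed

lemma subst_power: "subst h (p ^ e) = subst h p ^ e"
  by (induction e) (simp_all add: subst_mult)

lemma subst_prod: "subst h (\<Prod>x \<in> A. g x) = (\<Prod>x \<in> A. subst h (g x))"
  by (induction A rule: infinite_finite_induct) (simp_all add: subst_mult)

lemma subst_Const [simp]: "subst h (Const c) = Const c"
  using subst_single[of h 0 c] by (simp add: Const_def)

lemma subst_subst: "subst g (subst h p) = subst (\<lambda>i. subst g (h i)) p"
  by (simp add: subst_def[of h p] subst_def[of _ p] subst_sum subst_mult subst_prod subst_power)

lemma monomial_value_Var: "monomial_value Var u = Poly_Mapping.single u 1"
proof (induction u rule: Poly_Mapping.update_induct)
  case (update u i e)
  then have "Poly_Mapping.update i e u = u + Poly_Mapping.single i e"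
    by (intro poly_mapping_eqI) (auto simp: lookup_update lookup_add lookup_single in_keys_iff)
  moreover have "(Var i :: 'a mpoly) ^ e = Poly_Mapping.single (Poly_Mapping.single i e) 1"
    by (induction e) (simp_all add: Var_def mult_single flip: single_add)
  ultimately show ?case
    using update by (simp add: monomial_value_add mult_single)
qed simp

lemma Const_times_single: "Const c * Poly_Mapping.single u b = Poly_Mapping.single u (c * b)"
  by (simp add: Const_def mult_single)

lemma subst_identity [simp]: "subst Var p = p"
  unfolding subst_def monomial_value_def[symmetric]
  by (simp add: monomial_value_Var Const_times_single sum_of_monomials)

lemma polys_diff:
  "p \<in> polys N \<Longrightarrow> q \<in> polys N \<Longrightarrow> p - q \<in> polys N"
  using polys_closed(3)[of p N "- q"] polys_closed(4)[of q N] by simp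

lemma polys_sum: "(\<And>x. x \<in> A \<Longrightarrow> g x \<in> polys N) \<Longrightarrow> (\<Sum>x \<in> A. g x) \<in> polys N"
  by (induction A rule: infinite_finite_induct) (auto intro: polys_closed)

lemma polys_prod: "(\<And>x. x \<in> A \<Longrightarrow> g x \<in> polys N) \<Longrightarrow> (\<Prod>x \<in> A. g x) \<in> polys N"
  by (induction A rule: infinite_finite_induct) (auto intro: polys_closed)

lemma polys_power: "p \<in> polys N \<Longrightarrow> p ^ e \<in> polys N"
  by (induction e) (auto intro: polys_closed)

lemma polys_single: "Poly_Mapping.keys u \<subseteq> {..<N} \<Longrightarrow> Poly_Mapping.single u c \<in> polys N"
  by (simp add: polys_def)

lemma polys_Const: "Const c \<in> polys N"
  by (simp add: Const_def polys_single)

lemma polys_Var: "i < N \<Longrightarrow> Var i \<in> polys N"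
  by (simp add: Var_def polys_single)

lemma polys_subst:
  assumes "p \<in> polys N" "\<And>i. i < N \<Longrightarrow> h i \<in> polys M"
  shows "subst h p \<in> polys M"
  unfolding subst_def
  by (intro polys_sum polys_closed(5) polys_prod polys_power polys_Const)
     (use assms in \<open>force simp: polys_def\<close>)

section \<open>Gradings\<close>

lemma weighted_degree_superset:
  assumes "finite A" "Poly_Mapping.keys u \<subseteq> A"
  shows "weighted_degree a u = (\<Sum>i \<in> A. a i * Poly_Mapping.lookup u i)"
  unfolding weighted_degree_def
  by (rule sum.mono_neutral_left) (use assms in \<open>auto simp: in_keys_iff\<close>)

lemma weighted_degree_add: "weighted_degree a (u + v) = weighted_degree a u + weighted_degree a v"
proof -
  let ?A = "Poly_Mapping.keys u \<union> Poly_Mapping.keys v"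
  have "Poly_Mapping.keys (u + v) \<subseteq> ?A" by (rule Poly_Mapping.keys_add)
  then show ?thesis
    by (simp add: weighted_degree_superset[of ?A] lookup_add distrib_left sum.distrib)
qed

lemma weighted_degree_zero [simp]: "weighted_degree a 0 = 0"
  by (simp add: weighted_degree_def)

lemma weighted_degree_single [simp]: "weighted_degree a (Poly_Mapping.single i e) = a i * e"
  by (simp add: weighted_degree_def)

lemma weighted_degree_sum: "weighted_degree v (\<Sum>x\<in>I. g x) = (\<Sum>x\<in>I. weighted_degree v (g x))"
  by (induction I rule: infinite_finite_induct) (simp_all add: weighted_degree_add)

lemma homogeneous_zero [simp]: "weighted_homogeneous a d 0"
  by (simp add: weighted_homogeneous_def)

lemma homogeneous_add:
  "weighted_homogeneous a d p \<Longrightarrow> weighted_homogeneous a d q \<Longrightarrow> weighted_homogeneous a d (p + q)"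
  using Poly_Mapping.keys_add[of p q] by (auto simp: weighted_homogeneous_def)

lemma homogeneous_uminus: "weighted_homogeneous a d p \<Longrightarrow> weighted_homogeneous a d (- p)"
  by (simp add: weighted_homogeneous_def)

lemma homogeneous_diff:
  "weighted_homogeneous a d p \<Longrightarrow> weighted_homogeneous a d q \<Longrightarrow> weighted_homogeneous a d (p - q)"
  using homogeneous_add[of a d p "- q"] homogeneous_uminus[of a d q] by simp

lemma homogeneous_sum:
  "(\<And>x. x \<in> A \<Longrightarrow> weighted_homogeneous a d (g x)) \<Longrightarrow> weighted_homogeneous a d (\<Sum>x \<in> A. g x)"
  by (induction A rule: infinite_finite_induct) (auto intro: homogeneous_add)

lemma homogeneous_mult:
  assumes "weighted_homogeneous a d p" "weighted_homogeneous a e q"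
  shows "weighted_homogeneous a (d + e) (p * q)"
  unfolding weighted_homogeneous_def
proof
  fix u assume "u \<in> Poly_Mapping.keys (p * q)"
  then obtain v w where "u = v + w" "v \<in> Poly_Mapping.keys p" "w \<in> Poly_Mapping.keys q"
    using keys_mult[of p q] by blast
  then show "weighted_degree a u = d + e"
    using assms by (simp add: weighted_homogeneous_def weighted_degree_add)
qed

lemma homogeneous_one: "weighted_homogeneous a 0 1"
  by (simp add: weighted_homogeneous_def)

lemma homogeneous_power: "weighted_homogeneous a d p \<Longrightarrow> weighted_homogeneous a (d * e) (p ^ e)"
  by (induction e) (auto intro: homogeneous_one homogeneous_mult)

lemma homogeneous_prod:
  "(\<And>x. x \<in> A \<Longrightarrow> weighted_homogeneous a (d x) (g x)) \<Longrightarrow>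
   weighted_homogeneous a (\<Sum>x \<in> A. d x) (\<Prod>x \<in> A. g x)"
  by (induction A rule: infinite_finite_induct) (auto intro: homogeneous_one homogeneous_mult)

lemma homogeneous_Const: "weighted_homogeneous a 0 (Const c)"
  by (simp add: weighted_homogeneous_def Const_def)

lemma homogeneous_Var: "weighted_homogeneous a (a i) (Var i)"
  by (simp add: weighted_homogeneous_def Var_def)

lemma homogeneous_subst:
  assumes p: "p \<in> polys N" "weighted_homogeneous b d p"
    and h: "\<And>i. i < N \<Longrightarrow> weighted_homogeneous a (e * b i) (h i)"
  shows "weighted_homogeneous a (e * d) (subst h p)"
  unfolding subst_def
proof (rule homogeneous_sum)
  fix u assume u: "u \<in> Poly_Mapping.keys p"
  have "weighted_homogeneous a (\<Sum>i \<in> Poly_Mapping.keys u. e * b i * Poly_Mapping.lookup u i)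
      (\<Prod>i \<in> Poly_Mapping.keys u. h i ^ Poly_Mapping.lookup u i)"
    by (intro homogeneous_prod homogeneous_power h) (use u p in \<open>force simp: polys_def\<close>)
  moreover have "(\<Sum>i \<in> Poly_Mapping.keys u. e * b i * Poly_Mapping.lookup u i) = e * d"
    using u p unfolding weighted_homogeneous_def weighted_degree_def
    by (simp add: mult.assoc flip: sum_distrib_left)
  ultimately show "weighted_homogeneous a (e * d)
      (Const (Poly_Mapping.lookup p u) * (\<Prod>i \<in> Poly_Mapping.keys u. h i ^ Poly_Mapping.lookup u i))"
    using homogeneous_mult[OF homogeneous_Const] by force
qed

text \<open>
  Two vectors of weighted homogeneous coordinates of the same point differ by a scalar \<open>t / s\<close>
  acting with the weights; the denominator is cleared.
\<close>

lemma subst_proportional: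
  assumes p: "p \<in> polys N" "weighted_homogeneous a d p"
    and gh: "\<And>i. i < N \<Longrightarrow> s ^ a i * g i = t ^ a i * h i"
  shows "s ^ d * subst g p = t ^ d * subst h p"
proof -
  have val: "s ^ d * monomial_value g u = t ^ d * monomial_value h u"
    if u: "u \<in> Poly_Mapping.keys p" for u
  proof -
    have d: "d = (\<Sum>i \<in> Poly_Mapping.keys u. a i * Poly_Mapping.lookup u i)"
      using p(2) u by (simp add: weighted_homogeneous_def weighted_degree_def)
    have "s ^ d * monomial_value g u =
        (\<Prod>i \<in> Poly_Mapping.keys u. (s ^ a i * g i) ^ Poly_Mapping.lookup u i)"
      by (simp add: d monomial_value_def power_sum power_mult power_mult_distrib prod.distrib)
    also have "\<dots> = (\<Prod>i \<in> Poly_Mapping.keys u. (t ^ a i * h i) ^ Poly_Mapping.lookup u i)"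
    proof (rule prod.cong)
      fix i assume "i \<in> Poly_Mapping.keys u"
      then have "i < N" using u p(1) by (force simp: polys_def)
      then show "(s ^ a i * g i) ^ Poly_Mapping.lookup u i =
          (t ^ a i * h i) ^ Poly_Mapping.lookup u i"
        by (simp add: gh)
    qed simp
    also have "\<dots> = t ^ d * monomial_value h u"
      by (simp add: d monomial_value_def power_sum power_mult power_mult_distrib prod.distrib)
    finally show ?thesis .
  qed
  show ?thesis
    unfolding subst_def monomial_value_def[symmetric] sum_distrib_left
    by (intro sum.cong refl) (simp add: val mult.left_commute[of _ "Const _"])
qed

lemma subst_scaled:
  assumes "p \<in> polys N" "weighted_homogeneous a d p" "\<And>i. i < N \<Longrightarrow> g i = t ^ a i * h i"
  shows "subst g p = t ^ d * subst h p"
  using subst_proportional[of p N a d 1 g t h] assms by simp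

lemma lookup_homogeneous_component:
  "Poly_Mapping.lookup (homogeneous_component a d p) u =
     (if weighted_degree a u = d then Poly_Mapping.lookup p u else 0)"
  unfolding homogeneous_component_def
  by (auto simp: lookup_sum lookup_single when_def in_keys_iff sum.If_cases
      if_distrib cong: if_cong)

lemma homogeneous_component_zero: "homogeneous_component a d 0 = 0"
  by (simp add: homogeneous_component_def)

lemma keys_homogeneous_component:
  "Poly_Mapping.keys (homogeneous_component a d p) =
     {u \<in> Poly_Mapping.keys p. weighted_degree a u = d}"
  by (auto simp: in_keys_iff lookup_homogeneous_component split: if_split_asm)

lemma homogeneous_component_homogeneous: "weighted_homogeneous a d (homogeneous_component a d p)"
  by (simp add: weighted_homogeneous_def keys_homogeneous_component)

lemma bihomogeneous_component:
  "weighted_homogeneous a d p \<Longrightarrow> weighted_homogeneous a d (homogeneous_component b s p)"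
  by (simp add: weighted_homogeneous_def keys_homogeneous_component)

lemma polys_component: "p \<in> polys N \<Longrightarrow> homogeneous_component a d p \<in> polys N"
  by (simp add: polys_def keys_homogeneous_component)

text \<open>
  Substitution multiplies degrees by \<open>e > 0\<close>, so distinct components of \<open>p\<close> stay in distinct
  degrees and cannot cancel.
\<close>

lemma homogeneous_component_subst:
  assumes p: "p \<in> polys N" and e: "0 < e"
    and h: "\<And>i. i < N \<Longrightarrow> weighted_homogeneous a (e * b i) (h i)"
  shows "subst h (homogeneous_component b d p) = homogeneous_component a (e * d) (subst h p)"
proof (rule poly_mapping_eqI)
  fix u
  let ?D = "weighted_degree b ` Poly_Mapping.keys p"
  have split: "p = (\<Sum>d' \<in> insert d ?D. homogeneous_component b d' p)"
    by (rule poly_mapping_eqI)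
       (auto simp: lookup_sum lookup_homogeneous_component in_keys_iff sum.delta)
  have hom: "weighted_homogeneous a (e * d') (subst h (homogeneous_component b d' p))" for d'
    by (rule homogeneous_subst[OF polys_component[OF p] homogeneous_component_homogeneous h])
  have zero: "Poly_Mapping.lookup (subst h (homogeneous_component b d' p)) u = 0"
    if "weighted_degree a u \<noteq> e * d'" for d'
    using hom[of d'] that by (auto simp: weighted_homogeneous_def in_keys_iff)
  have "subst h p = (\<Sum>d' \<in> insert d ?D. subst h (homogeneous_component b d' p))"
    by (subst split) (rule subst_sum)
  then have "Poly_Mapping.lookup (subst h p) u =
      (\<Sum>d' \<in> insert d ?D. Poly_Mapping.lookup (subst h (homogeneous_component b d' p)) u)"
    by (simp only: lookup_sum)
  also have "\<dots> = Poly_Mapping.lookup (subst h (homogeneous_component b d p)) u"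
    if "weighted_degree a u = e * d"
    using that e by (subst sum.remove[of _ d]) (auto intro!: sum.neutral zero)
  finally show "Poly_Mapping.lookup (subst h (homogeneous_component b d p)) u =
      Poly_Mapping.lookup (homogeneous_component a (e * d) (subst h p)) u"
    using zero by (simp add: lookup_homogeneous_component)
qed

lemma divide_by_Var:
  assumes "\<And>u. u \<in> Poly_Mapping.keys p \<Longrightarrow> Poly_Mapping.lookup u i \<noteq> 0"
  obtains q where "p = Var i * q" "\<And>N. p \<in> polys N \<Longrightarrow> q \<in> polys N"
    "\<And>v D. weighted_homogeneous v D p \<Longrightarrow> weighted_homogeneous v (D - v i) q"
proof -
  define r where "r u = u - Poly_Mapping.single i 1" for u :: monomial
  have r: "u = Poly_Mapping.single i 1 + r u" if "u \<in> Poly_Mapping.keys p" for u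
    using assms[OF that]
    by (intro poly_mapping_eqI) (auto simp: r_def lookup_add lookup_minus lookup_single when_def)
  define q where "q = (\<Sum>u\<in>Poly_Mapping.keys p. Poly_Mapping.single (r u) (Poly_Mapping.lookup p u))"
  have "p = (\<Sum>u\<in>Poly_Mapping.keys p. Poly_Mapping.single u (Poly_Mapping.lookup p u))"
    by (rule sum_of_monomials[symmetric])
  also have "\<dots> = Var i * q"
    unfolding q_def sum_distrib_left Var_def mult_single using r by (intro sum.cong) simp_all
  finally have "p = Var i * q" .
  moreover have "q \<in> polys N" if "p \<in> polys N" for N
    unfolding q_def
  proof (intro polys_sum polys_single)
    fix u assume u: "u \<in> Poly_Mapping.keys p"
    have "Poly_Mapping.keys (r u) \<subseteq> Poly_Mapping.keys u"
      by (auto simp: r_def in_keys_iff lookup_minus)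
    then show "Poly_Mapping.keys (r u) \<subseteq> {..<N}" using u that by (auto simp: polys_def)
  qed
  moreover have "weighted_homogeneous v (D - v i) q" if "weighted_homogeneous v D p" for v D
    unfolding q_def
  proof (rule homogeneous_sum)
    fix u assume u: "u \<in> Poly_Mapping.keys p"
    have "weighted_degree v (Poly_Mapping.single i 1 + r u) = D"
      using r[OF u] u that by (simp add: weighted_homogeneous_def)
    then have "weighted_degree v (r u) = D - v i"
      by (simp add: weighted_degree_add)
    then show "weighted_homogeneous v (D - v i)
        (Poly_Mapping.single (r u) (Poly_Mapping.lookup p u))"
      by (simp add: weighted_homogeneous_def)
  qed
  ultimately show ?thesis using that by blast
qed

section \<open>Points and vanishing ideals\<close>

text \<open>
  The point of weighted projective space with homogeneous coordinates \<open>h\<close>, which lie in a domain: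
  its ideal is prime as the kernel of a homomorphism to a domain, and homogeneous because the
  coordinates are homogeneous of degrees proportional to the weights.
\<close>

lemma kernel_in_Proj:
  fixes h :: "nat \<Rightarrow> 'k::field mpoly"
  assumes e: "0 < e" and h: "\<And>i. i < N \<Longrightarrow> weighted_homogeneous a (e * b i) (h i)"
    and nonzero: "\<exists>i < N. h i \<noteq> 0"
  shows "{p \<in> polys N. subst h p = 0} \<in> Proj N b"
proof -
  let ?J = "{p \<in> polys N. subst h p = 0}"
  have "primeideal ?J (poly_ring N)"
  proof (rule primeidealI[OF idealI cring_poly_ring])
    show "ring (poly_ring N :: 'k mpoly ring)"
      by (rule cring.axioms(1)[OF cring_poly_ring])
    have inv: "inv\<^bsub>add_monoid (poly_ring N)\<^esub> p = - p" if "p \<in> polys N" for p :: "'k mpoly"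
    proof -
      interpret R: cring "poly_ring N :: 'k mpoly ring" by (rule cring_poly_ring)
      show ?thesis
        using R.minus_equality[of "- p" p] that
        by (simp add: a_inv_def poly_ring_def polys_closed)
    qed
    show "subgroup ?J (add_monoid (poly_ring N))"
      by unfold_locales
         (auto simp: poly_ring_def polys_closed subst_add subst_uminus
            inv[unfolded poly_ring_def, simplified])
    have "(1 :: 'k mpoly) \<in> polys N" "1 \<notin> ?J" by (auto intro: polys_closed)
    then show "carrier (poly_ring N) \<noteq> ?J"
      unfolding poly_ring_def by force
  qed (auto simp: poly_ring_def polys_closed subst_mult)
  moreover have "homogeneous_ideal b ?J"
    unfolding homogeneous_ideal_def
  proof clarify
    fix p d assume p: "p \<in> polys N" "subst h p = 0"
    have "subst h (homogeneous_component b d p) = homogeneous_component a (e * d) (subst h p)"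
      by (rule homogeneous_component_subst[OF p(1) e h])
    then show "homogeneous_component b d p \<in> polys N \<and> subst h (homogeneous_component b d p) = 0"
      using p by (simp add: polys_component homogeneous_component_zero)
  qed
  moreover have "\<not> Var ` {..<N} \<subseteq> ?J"
    using nonzero by auto
  ultimately show ?thesis
    by (simp add: Proj_def)
qed

lemma Proj_closed:
  assumes "P \<in> Proj N a"
  shows "0 \<in> P" and "p \<in> P \<Longrightarrow> q \<in> P \<Longrightarrow> p + q \<in> P"
    and "p \<in> P \<Longrightarrow> q \<in> polys N \<Longrightarrow> q * p \<in> P" and "P \<subseteq> polys N"
    and "p \<in> polys N \<Longrightarrow> q \<in> polys N \<Longrightarrow> p * q \<in> P \<Longrightarrow> p \<in> P \<or> q \<in> P"
    and "p \<in> P \<Longrightarrow> homogeneous_component a d p \<in> P"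
proof -
  interpret primeideal P "poly_ring N" using assms by (simp add: Proj_def)
  show "0 \<in> P"
      using additive_subgroup.zero_closed[OF is_additive_subgroup] by (simp add: poly_ring_def)
  show "p \<in> P \<Longrightarrow> q \<in> P \<Longrightarrow> p + q \<in> P" 
    using additive_subgroup.a_closed[OF is_additive_subgroup, of p q] by (simp add: poly_ring_def)
  show "p \<in> P \<Longrightarrow> q \<in> polys N \<Longrightarrow> q * p \<in> P" using I_l_closed by (simp add: poly_ring_def)
  show "P \<subseteq> polys N" using a_subset by (simp add: poly_ring_def)
  show "p \<in> polys N \<Longrightarrow> q \<in> polys N \<Longrightarrow> p * q \<in> P \<Longrightarrow> p \<in> P \<or> q \<in> P"
    using I_prime by (simp add: poly_ring_def)
  show "p \<in> P \<Longrightarrow> homogeneous_component a d p \<in> P"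
    using assms by (simp add: Proj_def homogeneous_ideal_def)
qed

lemma vanishing_ideal_hypersurface:
  "vanishing_ideal (hypersurface N a f) = {p \<in> polys N. \<forall>P \<in> Proj N a. f \<in> P \<longrightarrow> p \<in> P}"
  by (auto simp: vanishing_ideal_def hypersurface_def zero_locus_def)

lemma vanishing_ideal_closed:
  fixes f :: "'k::field mpoly" and N a
  defines "I \<equiv> vanishing_ideal (hypersurface N a f)"
  shows "p \<in> I \<Longrightarrow> q \<in> I \<Longrightarrow> p + q \<in> I" and "p \<in> I \<Longrightarrow> q \<in> polys N \<Longrightarrow> q * p \<in> I" and "0 \<in> I"
    and "f \<in> polys N \<Longrightarrow> f \<in> I"
  by (auto simp: I_def vanishing_ideal_hypersurface polys_closed Proj_closed)

text \<open>
  The generic point of projective space is the zero ideal, the kernel of substituting the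
  variables.
\<close>

lemma vanishing_ideal_projective_space: "vanishing_ideal (projective_space r) = {0}"
proof -
  have "{p \<in> polys (r + 1). subst Var p = 0} \<in> Proj (r + 1) (\<lambda>_. 1)"
    using homogeneous_Var[of "\<lambda>_. 1"] by (intro kernel_in_Proj[of 1 _ "\<lambda>_. 1"]) auto
  then have "{0} \<in> Proj (r + 1) (\<lambda>_. 1)"
    by (rule back_subst[of "\<lambda>P. P \<in> _"]) (auto intro: polys_closed)
  then show ?thesis
    by (auto simp: vanishing_ideal_def projective_space_def weighted_projective_space_def
        polys_closed Proj_closed)
qed

text \<open>
  Topological irreducibility makes the vanishing ideal prime on homogeneous elements: if \<open>p q\<close>
  vanishes on the hypersurface, the closed sets \<open>p = 0\<close> and \<open>q = 0\<close> cover it.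
\<close>

lemma vanishing_ideal_prime:
  assumes irr: "irreducible_set (hypersurface N a f)"
    and p: "p \<in> polys N" "weighted_homogeneous a d p"
    and q: "q \<in> polys N" "weighted_homogeneous a e q"
    and pq: "p * q \<in> vanishing_ideal (hypersurface N a f)"
  shows "p \<in> vanishing_ideal (hypersurface N a f) \<or> q \<in> vanishing_ideal (hypersurface N a f)"
proof -
  have closed: "zariski_closed N a (zero_locus N a {p})" "zariski_closed N a (zero_locus N a {q})"
    unfolding zariski_closed_def using p q by blast+
  moreover have "zero_locus N a {f} \<subseteq> zero_locus N a {p} \<union> zero_locus N a {q}"
    using pq Proj_closed(5) p q
    by (fastforce simp: vanishing_ideal_hypersurface zero_locus_def)
  ultimately have "zero_locus N a {f} \<subseteq> zero_locus N a {p} \<or>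
      zero_locus N a {f} \<subseteq> zero_locus N a {q}"
    using irr unfolding irreducible_set_def hypersurface_def by simp
  then show ?thesis
    using p q by (auto simp: vanishing_ideal_hypersurface zero_locus_def)
qed

section \<open>A criterion for rationality\<close>

text \<open>
  The hypotheses \<open>vanish\<close> and \<open>generic\<close> say that \<open>\<psi>\<close> is a generic point of \<open>X\<close>, so an identity
  between homogeneous forms on \<open>X\<close> can be tested after substituting \<open>\<psi>\<close>. By \<open>inverse\<close>, \<open>\<phi> \<circ> \<psi>\<close> is
  the identity up to a scalar. Therefore \<open>\<psi> \<circ> \<phi> \<circ> \<psi>\<close> is \<open>\<psi>\<close> up to a scalar, and testing on \<open>\<psi>\<close>
  shows that \<open>\<psi> \<circ> \<phi>\<close> is the identity of \<open>X\<close>.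
\<close>

lemma rational_variety_criterion:
  fixes X :: "'k::field projective_set"
  assumes \<psi>: "\<And>i. i < ncoords X \<Longrightarrow> \<psi> i \<in> polys (r + 1)"
      "\<And>i. i < ncoords X \<Longrightarrow> weighted_homogeneous (\<lambda>_. 1) (e * weight X i) (\<psi> i)"
    and \<phi>: "\<And>j. j \<le> r \<Longrightarrow> \<phi> j \<in> polys (ncoords X)"
      "\<And>j. j \<le> r \<Longrightarrow> weighted_homogeneous (weight X) e' (\<phi> j)"
    and \<psi>_nonzero: "\<exists>i < ncoords X. \<psi> i \<noteq> 0"
    and vanish: "\<And>F. F \<in> vanishing_ideal X \<Longrightarrow> subst \<psi> F = 0"
    and generic: "\<And>F d. F \<in> polys (ncoords X) \<Longrightarrow> weighted_homogeneous (weight X) d F \<Longrightarrow>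
      subst \<psi> F = 0 \<Longrightarrow> F \<in> vanishing_ideal X"
    and inverse: "\<And>j. j \<le> r \<Longrightarrow> Var 0 * subst \<psi> (\<phi> j) = subst \<psi> (\<phi> 0) * Var j"
    and inverse_nonzero: "subst \<psi> (\<phi> 0) \<noteq> 0"
  shows "rational_variety r X"
proof -
  let ?Y = "projective_space r :: 'k projective_set"
  let ?N = "ncoords X" and ?a = "weight X" and ?g = "subst \<psi> (\<phi> 0)"
  let ?\<chi> = "compose_maps \<psi> \<phi>" and ?\<theta> = "compose_maps \<phi> \<psi>"
  have Y [simp]: "ncoords ?Y = r + 1" "weight ?Y = (\<lambda>_. 1)" "vanishing_ideal ?Y = {0}"
    by (simp_all add: vanishing_ideal_projective_space)
       (simp_all add: projective_space_def weighted_projective_space_def)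
  have zero: "(0 :: 'k mpoly) \<in> vanishing_ideal X"
    by (rule generic[of 0 0]) (auto intro: polys_closed)

  have \<theta>: "Var 0 ^ d * subst ?\<theta> F = ?g ^ d * F"
    if "F \<in> polys (r + 1)" "weighted_homogeneous (\<lambda>_. 1) d F" for F d
    using subst_proportional[OF that, of "Var 0" "?\<theta>" "?g" Var] inverse
    by (simp add: compose_maps_def)
  \<comment> \<open>The composite \<open>\<psi> \<circ> \<phi> \<circ> \<psi>\<close>, computed by applying \<open>\<theta>\<close> to the coordinates of \<open>\<psi>\<close>.\<close>
  have \<chi>: "(Var 0 ^ e) ^ d * subst \<psi> (subst ?\<chi> F) = (?g ^ e) ^ d * subst \<psi> F"
    if "F \<in> polys ?N" "weighted_homogeneous ?a d F" for F d
    unfolding subst_subst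
  proof (rule subst_proportional[OF that])
    fix i assume i: "i < ?N"
    show "(Var 0 ^ e) ^ ?a i * subst \<psi> (?\<chi> i) = (?g ^ e) ^ ?a i * \<psi> i"
      using \<theta>[OF \<psi>[OF i]] by (simp add: compose_maps_def subst_subst power_mult)
  qed

  have \<phi>_map: "rational_map X ?Y \<phi>"
    unfolding rational_map_def
  proof (intro conjI)
    show "\<exists>e. \<forall>j<ncoords ?Y. \<phi> j \<in> polys ?N \<and>
        weighted_homogeneous ?a (e * weight ?Y j) (\<phi> j)"
      using \<phi> by (auto intro!: exI[of _ e'])
    show "\<exists>j<ncoords ?Y. \<phi> j \<notin> vanishing_ideal X"
      using vanish[of "\<phi> 0"] inverse_nonzero by (auto intro!: exI[of _ 0])
  qed (simp add: zero)
  have \<psi>_map: "rational_map ?Y X \<psi>"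
    unfolding rational_map_def
    using \<psi> vanish \<psi>_nonzero by (auto intro!: exI[of _ e])

  have \<chi>_polys: "?\<chi> i \<in> polys ?N" if "i < ?N" for i
    unfolding compose_maps_def using \<psi>(1)[OF that] \<phi>(1) by (intro polys_subst[of _ "r + 1"]) auto
  have \<chi>_wh: "weighted_homogeneous ?a (e' * e * ?a i) (?\<chi> i)" if "i < ?N" for i
    using homogeneous_subst[OF \<psi>[OF that], of ?a e' \<phi>] \<phi>(2)
        by (simp add: compose_maps_def mult.assoc)
  have \<chi>_map: "rational_map X X ?\<chi>"
    unfolding rational_map_def
  proof (intro conjI ballI)
    show "\<exists>e. \<forall>j<?N. ?\<chi> j \<in> polys ?N \<and> weighted_homogeneous ?a (e * ?a j) (?\<chi> j)"
      using \<chi>_polys \<chi>_wh by blast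
    obtain i where i: "i < ?N" "\<psi> i \<noteq> 0" using \<psi>_nonzero by blast
    have "subst \<psi> (?\<chi> i) \<noteq> 0"
      using \<chi>[of "Var i" "?a i"] i inverse_nonzero by (auto simp: polys_Var homogeneous_Var)
    then show "\<exists>j<?N. ?\<chi> j \<notin> vanishing_ideal X" using i vanish by blast
    fix F assume "F \<in> vanishing_ideal X"
    then have "subst ?\<chi> F = 0"
      using vanish[of F] subst_subst[of \<phi> \<psi> F] by (simp add: compose_maps_def)
    then show "subst ?\<chi> F \<in> vanishing_ideal X" using zero by simp
  qed
  have \<chi>_same: "same_rational_map X X ?\<chi> Var"
    unfolding same_rational_map_def
  proof (intro allI ballI impI)
    fix d and F G :: "'k mpoly" assume FG: "F \<in> polys ?N" "G \<in> polys ?N"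
      "weighted_homogeneous ?a d F \<and> weighted_homogeneous ?a d G"
    let ?D = "subst ?\<chi> F * subst Var G - subst Var F * subst ?\<chi> G"
    have \<chi>F: "subst ?\<chi> H \<in> polys ?N" "weighted_homogeneous ?a (e' * e * d) (subst ?\<chi> H)"
      if "H \<in> {F, G}" for H
      using FG that \<chi>_polys \<chi>_wh by (auto intro!: polys_subst[of _ ?N] homogeneous_subst[of _ ?N])
    have "?D \<in> polys ?N"
      using FG \<chi>F by (auto intro!: polys_diff polys_closed)
    moreover have "weighted_homogeneous ?a (e' * e * d + d) ?D"
    proof (rule homogeneous_diff)
      show "weighted_homogeneous ?a (e' * e * d + d) (subst ?\<chi> F * subst Var G)"
        using FG \<chi>F by (auto intro: homogeneous_mult)
      show "weighted_homogeneous ?a (e' * e * d + d) (subst Var F * subst ?\<chi> G)"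
        using homogeneous_mult[of ?a "e' * e * d" "subst ?\<chi> G" d F]
            FG \<chi>F by (simp add: mult.commute)
    qed
    moreover have "(Var 0 ^ e) ^ d * subst \<psi> ?D = 0"
      using \<chi>[of F d] \<chi>[of G d] FG
      by (simp add: subst_diff subst_mult right_diff_distrib mult.left_commute
          flip: mult.assoc)
    ultimately show "?D \<in> vanishing_ideal X"
      by (intro generic) auto
  qed

  have \<theta>_polys: "?\<theta> j \<in> polys (r + 1)" if "j \<le> r" for j
    unfolding compose_maps_def using \<phi>(1)[OF that] \<psi>(1) by (intro polys_subst[of _ ?N]) auto
  have \<theta>_wh: "weighted_homogeneous (\<lambda>_. 1) (e * e') (?\<theta> j)" if "j \<le> r" for j
    using homogeneous_subst[OF \<phi>[OF that]] \<psi>(2) by (simp add: compose_maps_def)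
  have \<theta>_map: "rational_map ?Y ?Y ?\<theta>"
    unfolding rational_map_def
  proof (intro conjI)
    show "\<exists>e. \<forall>j<ncoords ?Y. ?\<theta> j \<in> polys (ncoords ?Y) \<and>
        weighted_homogeneous (weight ?Y) (e * weight ?Y j) (?\<theta> j)"
      using \<theta>_polys \<theta>_wh by (auto intro!: exI[of _ "e * e'"])
    show "\<exists>j<ncoords ?Y. ?\<theta> j \<notin> vanishing_ideal ?Y"
      using inverse_nonzero by (auto intro!: exI[of _ 0] simp: compose_maps_def)
  qed simp
  have \<theta>_same: "same_rational_map ?Y ?Y ?\<theta> Var"
    unfolding same_rational_map_def
  proof (intro allI ballI impI)
    fix d and F G :: "'k mpoly"
    assume FG: "F \<in> polys (ncoords ?Y)" "G \<in> polys (ncoords ?Y)"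
      "weighted_homogeneous (weight ?Y) d F \<and> weighted_homogeneous (weight ?Y) d G"
    let ?D = "subst ?\<theta> F * subst Var G - subst Var F * subst ?\<theta> G"
    have "Var 0 ^ d * ?D = 0"
      using \<theta>[of F d] \<theta>[of G d] FG
      by (simp add: right_diff_distrib mult.left_commute flip: mult.assoc)
    then show "?D \<in> vanishing_ideal ?Y" by simp
  qed
  show ?thesis
    unfolding rational_variety_def birational_map_def
    using \<phi>_map \<psi>_map \<chi>_map \<chi>_same \<theta>_map \<theta>_same by blast
qed

section \<open>Completing weights to a basis of the lattice of exponents\<close>

text \<open>
  The vectors \<open>w k\<close> for \<open>k \<in> B\<close> are a basis of the kernel of the functional \<open>a\<close> on the lattice of
  integer vectors indexed by \<open>T\<close>, and \<open>u\<close> completes them to a basis of that lattice; the \<open>c l\<close> are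
  the corresponding coordinate functionals. That these vectors generate the lattice is expressed
  by the joint injectivity of the functionals, because this is the form in which it is applied.
\<close>

definition kernel_basis ::
    "nat set \<Rightarrow> nat set \<Rightarrow> (nat \<Rightarrow> nat) \<Rightarrow> (nat \<Rightarrow> nat \<Rightarrow> int) \<Rightarrow> (nat \<Rightarrow> nat \<Rightarrow> int)
        \<Rightarrow> (nat \<Rightarrow> int) \<Rightarrow> bool" where
  "kernel_basis T B a c w u \<longleftrightarrow>
    (\<forall>k \<in> B. (\<Sum>i \<in> T. int (a i) * w k i) = 0) \<and>
    (\<forall>k \<in> B. \<forall>l \<in> B. (\<Sum>i \<in> T. c l i * w k i) = (if k = l then 1 else 0)) \<and>
    (\<Sum>i \<in> T. int (a i) * u i) = int (Gcd (a ` T)) \<and>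
    (\<forall>l \<in> B. (\<Sum>i \<in> T. c l i * u i) = 0) \<and>
    (\<forall>\<alpha>. (\<forall>l \<in> B. (\<Sum>i \<in> T. c l i * \<alpha> i) = 0) \<longrightarrow>
        (\<Sum>i \<in> T. int (a i) * \<alpha> i) = 0 \<longrightarrow> (\<forall>i \<in> T. \<alpha> i = 0))"

text \<open>
  Induction on the number of weights. Adding an index \<open>s\<close> to \<open>T\<close>, the old vector \<open>u\<close> and the new
  unit vector span a plane on which \<open>a\<close> takes the values \<open>g'\<close> and \<open>a s\<close>; a Bezout identity for
  these numbers gives a unimodular change of basis of this plane, after which \<open>a\<close> vanishes on one
  vector and has the value \<open>gcd g' (a s)\<close> on the other.
\<close>

lemma kernel_basis_exists:
  fixes a :: "nat \<Rightarrow> nat"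
  assumes "finite B" "t \<notin> B" "\<And>i. i \<in> insert t B \<Longrightarrow> 0 < a i"
  shows "\<exists>c w u. kernel_basis (insert t B) B a c w u"
  using assms
proof (induction B rule: finite_induct)
  case empty
  have "kernel_basis {t} {} a (\<lambda>_ _. 0) (\<lambda>_ _. 0) (\<lambda>_. 1)"
    using empty by (simp add: kernel_basis_def)
  then show ?case by blast
next
  case (insert s B)
  let ?T = "insert t B"
  have fin: "finite ?T" "s \<notin> ?T" and eq: "insert t (insert s B) = insert s ?T"
    using insert by auto
  have sum_split: "(\<Sum>i \<in> insert t (insert s B). g i) = g s + (\<Sum>i \<in> ?T. g i)"
    for g :: "nat \<Rightarrow> int"
    unfolding eq by (rule sum.insert[OF fin])
  have sum_upd: "(\<Sum>i \<in> ?T. f i * (if i = s then x else g i)) = (\<Sum>i \<in> ?T. f i * g i)"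
    "(\<Sum>i \<in> ?T. (if i = s then x else g i) * f i) = (\<Sum>i \<in> ?T. g i * f i)"
    for x and f g :: "nat \<Rightarrow> int"
    using fin by (auto intro: sum.cong)
  obtain c w u where IH: "kernel_basis ?T B a c w u"
    using insert.IH insert.prems insert.hyps by auto
  have w: "\<And>k. k \<in> B \<Longrightarrow> (\<Sum>i \<in> ?T. int (a i) * w k i) = 0"
    and cw: "\<And>k l. k \<in> B \<Longrightarrow> l \<in> B \<Longrightarrow> (\<Sum>i \<in> ?T. c l i * w k i) = (if k = l then 1 else 0)"
    and u: "(\<Sum>i \<in> ?T. int (a i) * u i) = int (Gcd (a ` ?T))"
    and cu: "\<And>l. l \<in> B \<Longrightarrow> (\<Sum>i \<in> ?T. c l i * u i) = 0"
    and inj: "\<And>\<alpha>. (\<And>l. l \<in> B \<Longrightarrow> (\<Sum>i \<in> ?T. c l i * \<alpha> i) = 0) \<Longrightarrow>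
        (\<Sum>i \<in> ?T. int (a i) * \<alpha> i) = 0 \<Longrightarrow> (\<forall>i \<in> ?T. \<alpha> i = 0)"
    using IH unfolding kernel_basis_def by simp_all
  define g' g where "g' = int (Gcd (a ` ?T))" and "g = int (Gcd (a ` insert s ?T))"
  have g_gcd: "g = gcd g' (int (a s))"
    by (simp add: g_def g'_def gcd.commute flip: gcd_int_int_eq)
  have "a t > 0" using insert.prems by simp
  then have "Gcd (a ` ?T) \<noteq> 0" by (auto simp: Gcd_0_iff)
  then have g'_pos: "g' > 0" by (simp add: g'_def)
  then have g_pos: "g > 0" by (simp add: g_gcd)
  obtain p q where pq: "p * g' + q * int (a s) = g"
    using bezout_int[of g' "int (a s)"] unfolding g_gcd by blast
  define a' where "a' i = int (a i) div g'" for i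
  have a': "int (a i) = g' * a' i" if "i \<in> ?T" for i
  proof -
    have "g' dvd int (a i)" unfolding g'_def
        by (intro iffD2[OF int_dvd_int_iff] Gcd_dvd) (use that in auto)
    then show ?thesis by (simp add: a'_def)
  qed
  have sum_a': "(\<Sum>i \<in> ?T. int (a i) * \<alpha> i) = g' * (\<Sum>i \<in> ?T. a' i * \<alpha> i)" for \<alpha>
    unfolding sum_distrib_left by (rule sum.cong[OF refl]) (simp only: a' mult.assoc)
  have a'_w: "(\<Sum>i \<in> ?T. a' i * w k i) = 0" if "k \<in> B" for k
    using w[OF that] g'_pos by (simp add: sum_a')
  have a'_u: "(\<Sum>i \<in> ?T. a' i * u i) = 1"
    using u[folded g'_def] g'_pos by (simp add: sum_a')
  define x y where "x = g' div g" and "y = int (a s) div g"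
  have xy: "g' = g * x" "int (a s) = g * y"
    by (simp_all add: x_def y_def g_gcd)
  have "g * (p * x + q * y) = g * 1" using pq by (simp add: xy algebra_simps)
  then have det: "p * x + q * y = 1" using g_pos by simp
  \<comment> \<open>The matrix with rows \<open>(p, - q)\<close> and \<open>(y, x)\<close> has determinant 1; the new coordinates
      are taken with respect to it in the plane spanned by the unit vector at \<open>s\<close> and \<open>u\<close>.\<close>
  let ?c = "\<lambda>l i. if l = s then (if i = s then p else - q * a' i) else if i = s then 0 else c l i"
  let ?w = "\<lambda>k i. if k = s then (if i = s then x else - y * u i) else if i = s then 0 else w k i"
  let ?u = "\<lambda>i. if i = s then q else p * u i"
  have s: "s \<notin> B" using insert by simp
  show ?case
    unfolding kernel_basis_def
  proof (rule exI[of _ ?c], rule exI[of _ ?w], rule exI[of _ ?u], intro conjI ballI allI impI)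
    fix k assume k: "k \<in> insert s B"
    show "(\<Sum>i \<in> insert t (insert s B). int (a i) * ?w k i) = 0"
      using k s w u[folded g'_def] unfolding sum_split
      by (auto simp: sum_upd sum_negf mult.left_commute xy simp flip: sum_distrib_left)
    fix l assume l: "l \<in> insert s B"
    show "(\<Sum>i \<in> insert t (insert s B). ?c l i * ?w k i) = (if k = l then 1 else 0)"
      using k l s cw cu a'_w a'_u det unfolding sum_split
      by (cases "k = s"; cases "l = s")
         (simp_all add: sum_upd sum_negf mult.left_commute mult.assoc mult.commute[of q y]
           flip: sum_distrib_left)
  next
    show "(\<Sum>i \<in> insert t (insert s B). int (a i) * ?u i) = int (Gcd (a ` insert t (insert s B)))"
      unfolding sum_split unfolding eq g_def[symmetric]
      using u[folded g'_def] pq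
      by (simp add: sum_upd mult.left_commute[of _ p] mult.commute[of "int (a s)"]
          flip: sum_distrib_left)
  next
    fix l assume l: "l \<in> insert s B"
    show "(\<Sum>i \<in> insert t (insert s B). ?c l i * ?u i) = 0"
      using l s cu a'_u unfolding sum_split
      by (cases "l = s")
         (simp_all add: sum_upd sum_negf mult.left_commute mult.assoc mult.commute[of q p]
           flip: sum_distrib_left)
  next
    fix \<alpha> i
    assume c0: "\<forall>l\<in>insert s B. (\<Sum>i \<in> insert t (insert s B). ?c l i * \<alpha> i) = 0"
      and a0: "(\<Sum>i \<in> insert t (insert s B). int (a i) * \<alpha> i) = 0"
      and i: "i \<in> insert t (insert s B)"
    let ?z = "\<Sum>i \<in> ?T. a' i * \<alpha> i"
    have h1: "p * \<alpha> s - q * ?z = 0"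
      using c0[rule_format, of s] unfolding sum_split
      by (simp add: sum_upd sum_negf mult.assoc flip: sum_distrib_left)
    have "g * (y * \<alpha> s + x * ?z) = 0"
      using a0 unfolding sum_split by (simp add: sum_a' xy distrib_left mult.assoc)
    then have h2: "y * \<alpha> s + x * ?z = 0" using g_pos by simp
    have "(p * x + q * y) * \<alpha> s = x * (p * \<alpha> s - q * z) + q * (y * \<alpha> s + x * z)"
      "(p * x + q * y) * z = p * (y * \<alpha> s + x * z) - y * (p * \<alpha> s - q * z)" for z
      by (simp_all add: algebra_simps)
    from this[of ?z] have "(p * x + q * y) * \<alpha> s = 0" "(p * x + q * y) * ?z = 0"
      by (simp_all only: h1 h2 mult_zero_right add_0 diff_0_right)
    then have 0: "\<alpha> s = 0" "?z = 0" using det by simp_all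
    have "\<forall>i \<in> ?T. \<alpha> i = 0"
    proof (rule inj)
      show "(\<Sum>i \<in> ?T. int (a i) * \<alpha> i) = 0" by (simp add: sum_a' 0)
      show "(\<Sum>i \<in> ?T. c l i * \<alpha> i) = 0" if "l \<in> B" for l
        using c0[rule_format, of l] that s 0 unfolding sum_split
        by (cases "l = s") (simp_all add: sum_upd)
    qed
    then show "\<alpha> i = 0" using 0 i by auto
  qed
qed

text \<open>
  A basis of the exponents of Laurent monomials that have weighted degree 0 and degree 0 in \<open>S\<close>,
  with its coordinate functionals. Outside \<open>S\<close> it is the kernel basis of the weights, completed by
  \<open>u\<close> of weighted degree 1. Each \<open>j \<in> S - {i0}\<close> contributes \<open>x_j / x_(i0)\<close>, corrected by a power
  of \<open>u\<close> to have weighted degree 0.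
\<close>

lemma bigraded_basis_exists:
  fixes a :: "nat \<Rightarrow> nat"
  assumes S: "S \<subseteq> {..<n + 2}" "i0 \<in> S"
    and pos: "\<And>i. i < n + 2 \<Longrightarrow> 0 < a i"
    and gcd: "Gcd (a ` ({..<n + 2} - S)) = 1"
  shows "\<exists>c w :: nat \<Rightarrow> nat \<Rightarrow> int.
    (\<forall>k \<in> {1..n}. (\<Sum>i<n+2. int (a i) * w k i) = 0 \<and> (\<Sum>i\<in>S. w k i) = 0 \<and>
       (\<forall>l \<in> {1..n}. (\<Sum>i<n+2. c l i * w k i) = (if k = l then 1 else 0))) \<and>
    (\<forall>\<alpha>. (\<forall>l \<in> {1..n}. (\<Sum>i<n+2. c l i * \<alpha> i) = 0) \<longrightarrow> (\<Sum>i<n+2. int (a i) * \<alpha> i) = 0 \<longrightarrow>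
       (\<Sum>i\<in>S. \<alpha> i) = 0 \<longrightarrow> (\<forall>i<n+2. \<alpha> i = 0))"
proof -
  define T where "T = {..<n + 2} - S"
  have "T \<noteq> {}"
  proof
    assume "T = {}"
    then show False using gcd unfolding T_def[symmetric] by simp
  qed
  then obtain t where t: "t \<in> T" by blast
  define B where "B = T - {t}"
  have T: "T = insert t B" and fin: "finite S" "finite T" "finite B"
    using t S by (auto simp: B_def T_def intro: finite_subset)
  have "\<exists>c w u. kernel_basis (insert t B) B a c w u"
    by (rule kernel_basis_exists) (use fin pos t in \<open>auto simp: B_def T_def\<close>)
  then obtain c w u where "kernel_basis T B a c w u" unfolding T by blast
  then have w: "\<And>k. k \<in> B \<Longrightarrow> (\<Sum>i \<in> T. int (a i) * w k i) = 0"
    and cw: "\<And>k l. k \<in> B \<Longrightarrow> l \<in> B \<Longrightarrow> (\<Sum>i \<in> T. c l i * w k i) = (if k = l then 1 else 0)"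
    and u: "(\<Sum>i \<in> T. int (a i) * u i) = 1"
    and cu: "\<And>l. l \<in> B \<Longrightarrow> (\<Sum>i \<in> T. c l i * u i) = 0"
    and inj: "\<And>\<alpha>. (\<And>l. l \<in> B \<Longrightarrow> (\<Sum>i \<in> T. c l i * \<alpha> i) = 0) \<Longrightarrow>
        (\<Sum>i \<in> T. int (a i) * \<alpha> i) = 0 \<Longrightarrow> (\<forall>i \<in> T. \<alpha> i = 0)"
    using gcd unfolding kernel_basis_def T_def[symmetric] by simp_all
  have disj: "S \<inter> T = {}" by (auto simp: T_def)
  have split: "(\<Sum>i<n+2. g i) = (\<Sum>i\<in>S. g i) + (\<Sum>i\<in>T. g i)" for g :: "nat \<Rightarrow> int"
  proof -
    have "{..<n + 2} = S \<union> T" using S by (auto simp: T_def)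
    then show ?thesis using fin disj by (simp add: sum.union_disjoint)
  qed
  define c' where "c' j i =
    (if j \<in> S then if i = j then 1 else 0 else if i \<in> S then 0 else c j i)" for j i
  define w' where "w' j i =
    (if j \<in> S then (if i = j then 1 else 0) - (if i = i0 then 1 else 0)
        - (if i \<in> T then (int (a j) - int (a i0)) * u i else 0)
     else if i \<in> S then 0 else w j i)" for j i
  have notS: "i \<notin> S" if "i \<in> T" for i using that disj by auto
  have BT: "k \<in> T" if "k \<in> B" for k using that by (simp add: B_def)
  have cS: "(\<Sum>i<n+2. c' j i * \<alpha> i) = \<alpha> j" if "j \<in> S" for j and \<alpha> :: "nat \<Rightarrow> int"
    using that fin disj unfolding split
    by (auto simp: c'_def if_distrib[of "\<lambda>x. x * _"] sum.delta cong: if_cong)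
  have cB: "(\<Sum>i<n+2. c' j i * \<alpha> i) = (\<Sum>i\<in>T. c j i * \<alpha> i)" if "j \<in> B" for j and \<alpha> :: "nat \<Rightarrow> int"
    using notS[OF BT[OF that]] notS unfolding split by (simp add: c'_def cong: sum.cong)
  have w'S_T: "w' j i = - (int (a j) - int (a i0)) * u i" if "j \<in> S" "i \<in> T" for i j
    using that disj S by (auto simp: w'_def algebra_simps)
  have w'S_S: "w' j i = (if i = j then 1 else 0) - (if i = i0 then 1 else 0)"
    if "j \<in> S" "i \<in> S" for i j
    using that notS by (auto simp: w'_def)
  have w'B_S: "w' j i = 0" if "j \<in> B" "i \<in> S" for i j
    using notS[OF BT[OF that(1)]] that by (simp add: w'_def)
  have w'B_T: "w' j i = w j i" if "j \<in> B" "i \<in> T" for i j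
    using notS[OF BT[OF that(1)]] notS[OF that(2)] by (simp add: w'_def)
  define B' where "B' = B \<union> (S - {i0})"
  have sum_w': "(\<Sum>i\<in>S. w' k i) = 0" if "k \<in> B'" for k
    using that S(2) fin(1)
    by (auto simp: B'_def w'B_S w'S_S sum_subtractf)
  have a_w': "(\<Sum>i<n+2. int (a i) * w' k i) = 0" if "k \<in> B'" for k
  proof (cases "k \<in> B")
    case True
    then show ?thesis unfolding split by (simp add: w'B_S w'B_T w)
  next
    case False
    then have k: "k \<in> S" using that by (simp add: B'_def)
    have "(\<Sum>i\<in>S. int (a i) * w' k i) = int (a k) - int (a i0)"
      using k S(2) fin(1)
      by (simp add: w'S_S right_diff_distrib sum_subtractf if_distrib[of "(*) _"] cong: if_cong)
    moreover have "(\<Sum>i\<in>T. int (a i) * w' k i) =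
        - (int (a k) - int (a i0)) * (\<Sum>i\<in>T. int (a i) * u i)"
      unfolding sum_distrib_left using k by (simp add: w'S_T mult_ac)
    ultimately show ?thesis unfolding split by (simp add: u)
  qed
  have c_w': "(\<Sum>i<n+2. c' l i * w' k i) = (if k = l then 1 else 0)"
    if "k \<in> B'" "l \<in> B'" for k l
  proof (cases "l \<in> B")
    case l: True
    show ?thesis
    proof (cases "k \<in> B")
      case True
      then show ?thesis unfolding cB[OF l] using l by (simp add: w'B_T cw)
    next
      case False
      then have k: "k \<in> S" using that by (simp add: B'_def)
      have "(\<Sum>i\<in>T. c l i * w' k i) =
          - (int (a k) - int (a i0)) * (\<Sum>i\<in>T. c l i * u i)"
        unfolding sum_distrib_left using k by (simp add: w'S_T mult_ac)
      then show ?thesis unfolding cB[OF l] using False l by (auto simp: cu)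
    qed
  next
    case False
    then have l: "l \<in> S" "l \<noteq> i0" using that by (auto simp: B'_def)
    show ?thesis
      unfolding cS[OF l(1)] using that(1) l False by (auto simp: B'_def w'B_S w'S_S)
  qed
  have inj': "\<alpha> i = 0"
    if c0: "\<And>l. l \<in> B' \<Longrightarrow> (\<Sum>i<n+2. c' l i * \<alpha> i) = 0" and a0: "(\<Sum>i<n+2. int (a i) * \<alpha> i) = 0"
      and S0: "(\<Sum>i\<in>S. \<alpha> i) = 0" and i: "i < n + 2" for \<alpha> i
  proof -
    have 0: "\<alpha> j = 0" if "j \<in> S" "j \<noteq> i0" for j
      using c0[of j] cS[of j \<alpha>] that by (simp add: B'_def)
    have "(\<Sum>i\<in>S. \<alpha> i) = \<alpha> i0"
      using fin(1) S(2) 0 by (subst sum.remove[of _ i0]) auto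
    then have S_0: "\<alpha> j = 0" if "j \<in> S" for j
      using S0 0 that by (cases "j = i0") auto
    moreover have "\<forall>j \<in> T. \<alpha> j = 0"
    proof (rule inj)
      show "(\<Sum>i\<in>T. int (a i) * \<alpha> i) = 0" using a0 S_0 unfolding split by simp
      show "(\<Sum>i\<in>T. c l i * \<alpha> i) = 0" if "l \<in> B" for l
        using c0[of l] that unfolding cB[OF that] by (simp add: B'_def)
    qed
    ultimately show ?thesis using i by (auto simp: T_def)
  qed
  have "card B' = n"
  proof -
    have "{..<n + 2} = insert t (insert i0 B')" "t \<notin> insert i0 B'" "i0 \<notin> B'"
      using S t notS BT by (auto simp: B'_def B_def T_def)
    moreover have "finite B'" using fin by (simp add: B'_def)
    ultimately have "card {..<n + 2} = Suc (Suc (card B'))"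
      by (simp only: card_insert_disjoint finite_insert not_False_eq_True)
    then show ?thesis by simp
  qed
  then have "\<exists>\<beta>. bij_betw \<beta> {1..n} B'"
    using fin by (intro finite_same_card_bij) (auto simp: B'_def)
  then obtain \<beta> where \<beta>: "bij_betw \<beta> {1..n} B'" by blast
  then have mem: "\<beta> k \<in> B'" if "k \<in> {1..n}" for k
    using bij_betwE[OF \<beta>] that by blast
  have eq: "\<beta> k = \<beta> l \<longleftrightarrow> k = l" if "k \<in> {1..n}" "l \<in> {1..n}" for k l
    using inj_on_eq_iff[OF bij_betw_imp_inj_on[OF \<beta>]] that by simp
  show ?thesis
  proof (rule exI[of _ "\<lambda>k. c' (\<beta> k)"], rule exI[of _ "\<lambda>k. w' (\<beta> k)"],
      intro conjI ballI allI impI)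
    fix \<alpha> i
    assume "\<forall>l\<in>{1..n}. (\<Sum>i<n+2. c' (\<beta> l) i * \<alpha> i) = 0"
      and *: "(\<Sum>i<n+2. int (a i) * \<alpha> i) = 0" "(\<Sum>i\<in>S. \<alpha> i) = 0" "i < n + 2"
    then have "(\<Sum>i<n+2. c' l i * \<alpha> i) = 0" if "l \<in> B'" for l
      using that bij_betw_imp_surj_on[OF \<beta>] by blast
    then show "\<alpha> i = 0" by (rule inj') (use * in auto)
  qed (use mem a_w' sum_w' c_w' eq in auto)
qed

section \<open>Monomial coordinates\<close>

text \<open>
  With these weights, the weighted degree is the degree in the variables of \<open>S\<close>.
\<close>

abbreviation membership_weight :: "nat set \<Rightarrow> nat \<Rightarrow> nat" where
  "membership_weight S \<equiv> \<lambda>i. of_bool (i \<in> S)"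

lemma subst_monomials:
  assumes "\<And>i. h i = Poly_Mapping.single (\<mu> i) 1"
  shows "subst h (Poly_Mapping.single u c) =
    Poly_Mapping.single (\<Sum>i\<in>Poly_Mapping.keys u. \<Sum>j<Poly_Mapping.lookup u i. \<mu> i) c"
proof -
  have power: "Poly_Mapping.single \<nu> 1 ^ e = (Poly_Mapping.single (\<Sum>j<e. \<nu>) 1 :: 'a mpoly)" for \<nu> e
    by (induction e) (simp_all add: mult_single add.commute del: sum_constant)
  have "(\<Prod>i\<in>I. Poly_Mapping.single (\<nu> i) 1) = (Poly_Mapping.single (\<Sum>i\<in>I. \<nu> i) 1 :: 'a mpoly)"
    for I :: "nat set" and \<nu>
    by (induction I rule: infinite_finite_induct) (simp_all add: mult_single)
  then show ?thesis
    by (simp add: subst_single monomial_value_def assms power Const_times_single del: sum_constant)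
qed

text \<open>
  The data of \<open>bigraded_basis_exists\<close>. The vectors \<open>w k\<close> are the exponents of the coordinates
  \<open>z_k\<close>, to be identified with \<open>y_k / y_0\<close>, and \<open>c l i\<close> is the exponent of \<open>z_l\<close> in \<open>x_i\<close>.
\<close>

locale torus_chart =
  fixes n :: nat and a :: "nat \<Rightarrow> nat" and S :: "nat set" and c w :: "nat \<Rightarrow> nat \<Rightarrow> int"
  assumes weight_pos: "\<And>i. i < n + 2 \<Longrightarrow> 0 < a i"
    and S_subset: "S \<subseteq> {..<n + 2}"
    and weight_w: "\<And>k. k \<in> {1..n} \<Longrightarrow> (\<Sum>i<n+2. int (a i) * w k i) = 0"
    and sum_w: "\<And>k. k \<in> {1..n} \<Longrightarrow> (\<Sum>i\<in>S. w k i) = 0"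
    and c_w: "\<And>k l. k \<in> {1..n} \<Longrightarrow> l \<in> {1..n} \<Longrightarrow>
      (\<Sum>i<n+2. c l i * w k i) = (if k = l then 1 else 0)"
    and c_inj: "\<And>\<alpha> i. (\<And>l. l \<in> {1..n} \<Longrightarrow> (\<Sum>i<n+2. c l i * \<alpha> i) = 0) \<Longrightarrow>
      (\<Sum>i<n+2. int (a i) * \<alpha> i) = 0 \<Longrightarrow> (\<Sum>i\<in>S. \<alpha> i) = 0 \<Longrightarrow> i < n + 2 \<Longrightarrow> \<alpha> i = 0"
begin

abbreviation b :: "nat \<Rightarrow> nat" where
  "b \<equiv> membership_weight S"

text \<open>
  In terms of \<open>y_0, ..., y_n\<close> the monomial \<open>z_1^(c 1 i) ... z_n^(c n i)\<close> is a Laurent monomial of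
  degree 0, which determines the exponent of \<open>y_0\<close>.
\<close>

definition c_hom :: "nat \<Rightarrow> nat \<Rightarrow> int" where
  "c_hom l i = (if l = 0 then - (\<Sum>k\<in>{1..n}. c k i) else c l i)"

text \<open>
  The factor \<open>(y_0 ... y_n)^shift\<close>, raised to the weight \<open>a i\<close> in the \<open>i\<close>-th coordinate, clears
  all denominators and only rescales the weighted homogeneous coordinates.
\<close>

definition shift :: nat where
  "shift = 1 + nat (\<Sum>i<n+2. \<Sum>l\<in>{1..n}. \<bar>c l i\<bar>)"

definition chart_exponent :: "nat \<Rightarrow> nat \<Rightarrow> nat" where
  "chart_exponent i l = nat (c_hom l i + int (shift * a i))"

definition chart_degree :: nat where
  "chart_degree = (n + 1) * shift"

definition chart :: "nat \<Rightarrow> 'k::field mpoly" where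
  "chart i = Poly_Mapping.single (\<Sum>l\<le>n. Poly_Mapping.single l (chart_exponent i l)) 1"

lemma int_chart_exponent:
  assumes "i < n + 2" "l \<le> n"
  shows "int (chart_exponent i l) = c_hom l i + int (shift * a i)"
proof -
  have "\<bar>c_hom l i\<bar> \<le> (\<Sum>l\<in>{1..n}. \<bar>c l i\<bar>)"
    using assms(2) by (auto simp: c_hom_def intro!: member_le_sum)
  also have "\<dots> \<le> (\<Sum>i<n+2. \<Sum>l\<in>{1..n}. \<bar>c l i\<bar>)"
    using assms(1) by (intro member_le_sum) (auto intro: sum_nonneg)
  also have "\<dots> \<le> int shift" by (simp add: shift_def)
  also have "\<dots> \<le> int (shift * a i)"
    using weight_pos[OF assms(1)] by (intro zle_int[THEN iffD2]) simp
  finally show ?thesis by (simp add: chart_exponent_def)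
qed

lemma chart_degree_pos: "0 < chart_degree"
  by (simp add: chart_degree_def shift_def)

lemma polys_chart: "chart i \<in> polys (n + 1)"
proof -
  have "Poly_Mapping.keys (\<Sum>l\<le>n. Poly_Mapping.single l (chart_exponent i l)) \<subseteq> {..<n + 1}"
    by (auto simp: in_keys_iff lookup_sum lookup_single when_def split: if_splits)
  then show ?thesis unfolding chart_def by (rule polys_single)
qed

lemma chart_homogeneous:
  assumes "i < n + 2"
  shows "weighted_homogeneous (\<lambda>_. 1) (chart_degree * a i) (chart i)"
proof -
  have "(\<Sum>l\<le>n. c_hom l i) = 0"
    unfolding atMost_atLeast0 by (subst sum.atLeast_Suc_atMost) (simp_all add: c_hom_def)
  then have "int (\<Sum>l\<le>n. chart_exponent i l) = int (chart_degree * a i)"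
    using assms by (simp add: int_chart_exponent sum.distrib chart_degree_def
        distrib_right)
  then have "(\<Sum>l\<le>n. chart_exponent i l) = chart_degree * a i"
    by (simp only: of_nat_eq_iff)
  then show ?thesis
    by (simp add: weighted_homogeneous_def chart_def weighted_degree_sum)
qed

definition image_exponent :: "monomial \<Rightarrow> monomial" where
  "image_exponent u = (\<Sum>i\<in>Poly_Mapping.keys u. \<Sum>j<Poly_Mapping.lookup u i.
     \<Sum>l\<le>n. Poly_Mapping.single l (chart_exponent i l))"

lemma subst_chart_single:
  "subst chart (Poly_Mapping.single u x) = Poly_Mapping.single (image_exponent u) x"
  unfolding image_exponent_def by (rule subst_monomials) (simp add: chart_def)

lemma lookup_image_exponent:
  assumes "Poly_Mapping.keys u \<subseteq> {..<n + 2}"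
  shows "Poly_Mapping.lookup (image_exponent u) l =
    (if l \<le> n then \<Sum>i<n+2. Poly_Mapping.lookup u i * chart_exponent i l else 0)"
proof -
  have "Poly_Mapping.lookup (image_exponent u) l =
    (\<Sum>i\<in>Poly_Mapping.keys u. Poly_Mapping.lookup u i * (if l \<le> n then chart_exponent i l else 0))"
    unfolding image_exponent_def lookup_sum by (simp add: lookup_single when_def)
  also have "\<dots> = (\<Sum>i<n+2. Poly_Mapping.lookup u i * (if l \<le> n then chart_exponent i l else 0))"
    by (rule sum.mono_neutral_left) (use assms in \<open>auto simp: in_keys_iff\<close>)
  finally show ?thesis by simp
qed

lemma int_lookup_image_exponent:
  assumes "Poly_Mapping.keys u \<subseteq> {..<n + 2}" "l \<le> n"
  shows "int (Poly_Mapping.lookup (image_exponent u) l) =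
    (\<Sum>i<n+2. c_hom l i * int (Poly_Mapping.lookup u i)) + int (shift * weighted_degree a u)"
proof -
  have "int (Poly_Mapping.lookup (image_exponent u) l) =
      (\<Sum>i<n+2. int (Poly_Mapping.lookup u i) * (c_hom l i + int (shift * a i)))"
    unfolding lookup_image_exponent[OF assms(1)] using assms(2)
    by (simp only: if_True of_nat_sum of_nat_mult)
       (intro sum.cong refl, simp add: int_chart_exponent)
  also have "\<dots> = (\<Sum>i<n+2. c_hom l i * int (Poly_Mapping.lookup u i)) +
      int shift * (\<Sum>i<n+2. int (a i) * int (Poly_Mapping.lookup u i))"
    unfolding sum_distrib_left sum.distrib[symmetric]
    by (intro sum.cong refl) (simp add: algebra_simps)
  finally show ?thesis
    unfolding weighted_degree_superset[OF finite_lessThan assms(1)] by simp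
qed

lemma weighted_degree_membership:
  assumes "Poly_Mapping.keys u \<subseteq> {..<n + 2}"
  shows "int (weighted_degree b u) = (\<Sum>i\<in>S. int (Poly_Mapping.lookup u i))"
proof -
  have "int (weighted_degree b u) = (\<Sum>i<n+2. if i \<in> S then int (Poly_Mapping.lookup u i) else 0)"
    unfolding weighted_degree_superset[OF finite_lessThan assms] of_nat_sum
    by (intro sum.cong) auto
  also have "\<dots> = (\<Sum>i\<in>S. int (Poly_Mapping.lookup u i))"
    using S_subset by (subst sum.inter_restrict[symmetric]) (auto simp: Int_absorb1)
  finally show ?thesis .
qed

text \<open>
  The exponent of the image gives the coordinates \<open>c l\<close> of the exponent, and together with the two
  degrees these determine it.
\<close>

lemma image_exponent_inj:
  assumes u: "Poly_Mapping.keys u \<subseteq> {..<n + 2}" and v: "Poly_Mapping.keys v \<subseteq> {..<n + 2}"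
    and deg: "weighted_degree a u = weighted_degree a v" "weighted_degree b u = weighted_degree b v"
    and eq: "image_exponent u = image_exponent v"
  shows "u = v"
proof (rule poly_mapping_eqI)
  fix i
  let ?\<alpha> = "\<lambda>i. int (Poly_Mapping.lookup u i) - int (Poly_Mapping.lookup v i)"
  show "Poly_Mapping.lookup u i = Poly_Mapping.lookup v i"
  proof (cases "i < n + 2")
    case True
    have "?\<alpha> i = 0"
    proof (rule c_inj[of ?\<alpha>])
      show "(\<Sum>i<n+2. c l i * ?\<alpha> i) = 0" if "l \<in> {1..n}" for l
        using that int_lookup_image_exponent[OF u, of l] int_lookup_image_exponent[OF v, of l]
        unfolding right_diff_distrib sum_subtractf by (simp add: eq deg c_hom_def)
      show "(\<Sum>i<n+2. int (a i) * ?\<alpha> i) = 0"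
        using deg(1)[THEN arg_cong[of _ _ int]] unfolding right_diff_distrib sum_subtractf
        unfolding weighted_degree_superset[OF finite_lessThan u]
          weighted_degree_superset[OF finite_lessThan v] of_nat_sum of_nat_mult by linarith
      show "(\<Sum>i\<in>S. ?\<alpha> i) = 0"
        using deg(2)[THEN arg_cong[of _ _ int]] weighted_degree_membership[OF u]
          weighted_degree_membership[OF v] unfolding sum_subtractf by linarith
    qed (rule True)
    then show ?thesis by simp
  next
    case False
    then have "i \<notin> Poly_Mapping.keys u" "i \<notin> Poly_Mapping.keys v" using u v by auto
    then show ?thesis by (simp add: in_keys_iff)
  qed
qed

text \<open>
  By \<open>image_exponent_inj\<close>, distinct monomials of a bihomogeneous polynomial have distinct images,
  so nothing cancels.
\<close>

lemma subst_chart_nonzero: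
  assumes R: "R \<in> polys (n + 2)" "weighted_homogeneous a D R" "weighted_homogeneous b s R"
    and nonzero: "R \<noteq> 0"
  shows "subst chart R \<noteq> 0"
proof -
  have "Poly_Mapping.keys R \<noteq> {}"
    using nonzero by (metis poly_mapping_eqI not_in_keys_iff_lookup_eq_zero lookup_zero empty_iff)
  then obtain u where u: "u \<in> Poly_Mapping.keys R" by blast
  have "subst chart R = subst chart
      (\<Sum>v\<in>Poly_Mapping.keys R. Poly_Mapping.single v (Poly_Mapping.lookup R v))"
    by (simp add: sum_of_monomials)
  also have "\<dots> = (\<Sum>v\<in>Poly_Mapping.keys R.
      Poly_Mapping.single (image_exponent v) (Poly_Mapping.lookup R v))"
    by (simp add: subst_sum subst_chart_single)
  finally have "Poly_Mapping.lookup (subst chart R) (image_exponent u) =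
      (\<Sum>v\<in>Poly_Mapping.keys R. if image_exponent v = image_exponent u
        then Poly_Mapping.lookup R v else 0)"
    by (simp add: lookup_sum lookup_single when_def)
  also have "\<dots> = (\<Sum>v\<in>Poly_Mapping.keys R. if v = u then Poly_Mapping.lookup R v else 0)"
  proof (intro sum.cong refl)
    fix v assume v: "v \<in> Poly_Mapping.keys R"
    have "image_exponent v = image_exponent u \<longleftrightarrow> v = u"
      using image_exponent_inj[of v u] u v R by (auto simp: polys_def weighted_homogeneous_def)
    then show "(if image_exponent v = image_exponent u then Poly_Mapping.lookup R v else 0) =
        (if v = u then Poly_Mapping.lookup R v else 0)" by simp
  qed
  also have "\<dots> = Poly_Mapping.lookup R u" using u by simp
  finally show ?thesis using u by (auto simp: in_keys_iff)
qed

text \<open>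
  Exponents of monomials whose quotients by the monomial for \<open>k = 0\<close> are the Laurent monomials
  with exponents \<open>w k\<close>. The common summand makes them nonnegative. It is 0 at every coordinate at
  which all \<open>w k\<close> are 0. If \<open>S = {i0}\<close>, this includes \<open>i0\<close>, so the monomials do not involve
  \<open>x_(i0)\<close>, which may then vanish identically on the hypersurface.
\<close>

definition lift :: "nat \<Rightarrow> nat \<Rightarrow> int" where
  "lift k i = (\<Sum>l\<in>{1..n}. \<bar>w l i\<bar>) + (if k = 0 then 0 else w k i)"

definition lift_exponent :: "nat \<Rightarrow> monomial" where
  "lift_exponent k = (\<Sum>i<n+2. Poly_Mapping.single i (nat (lift k i)))"

lemma keys_lift_exponent: "Poly_Mapping.keys (lift_exponent k) \<subseteq> {..<n + 2}"
  by (auto simp: in_keys_iff lift_exponent_def lookup_sum lookup_single when_def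
      simp del: sum.lessThan_Suc split: if_splits)

lemma lookup_lift_exponent:
  assumes "i < n + 2" "k \<le> n"
  shows "int (Poly_Mapping.lookup (lift_exponent k) i) = lift k i"
proof -
  have "\<bar>w k i\<bar> \<le> (\<Sum>l\<in>{1..n}. \<bar>w l i\<bar>)" if "k \<noteq> 0"
    using that assms(2) by (intro member_le_sum) auto
  moreover have "0 \<le> (\<Sum>l\<in>{1..n}. \<bar>w l i\<bar>)" by (rule sum_nonneg) simp
  ultimately have "0 \<le> lift k i" by (auto simp: lift_def)
  moreover have "Poly_Mapping.lookup (lift_exponent k) i = nat (lift k i)"
    using assms(1)
    by (simp add: lift_exponent_def lookup_sum lookup_single when_def del: sum.lessThan_Suc)
  ultimately show ?thesis by simp
qed

lemma sum_lift_exponent: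
  assumes "k \<le> n"
  shows "(\<Sum>i<n+2. g i * int (Poly_Mapping.lookup (lift_exponent k) i)) =
    (\<Sum>i<n+2. g i * int (Poly_Mapping.lookup (lift_exponent 0) i)) +
    (if k = 0 then 0 else \<Sum>i<n+2. g i * w k i)"
proof -
  have "(\<Sum>i<n+2. g i * int (Poly_Mapping.lookup (lift_exponent k) i)) =
      (\<Sum>i<n+2. g i * int (Poly_Mapping.lookup (lift_exponent 0) i)
          + (if k = 0 then 0 else g i * w k i))"
    using assms by (intro sum.cong) (auto simp: lookup_lift_exponent lift_def distrib_left)
  then show ?thesis by (simp add: sum.distrib del: sum.lessThan_Suc)
qed

lemma weighted_degree_lift:
  assumes "k \<le> n"
  shows "weighted_degree a (lift_exponent k) = weighted_degree a (lift_exponent 0)"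
    and "weighted_degree b (lift_exponent k) = weighted_degree b (lift_exponent 0)"
proof -
  have "int (weighted_degree a (lift_exponent k)) = int (weighted_degree a (lift_exponent 0))"
    using sum_lift_exponent[OF assms, of "\<lambda>i. int (a i)"] weight_w[of k] assms
    unfolding weighted_degree_superset[OF finite_lessThan keys_lift_exponent] of_nat_sum of_nat_mult
    by (auto split: if_splits)
  then show "weighted_degree a (lift_exponent k) = weighted_degree a (lift_exponent 0)"
    by (simp only: of_nat_eq_iff)
  have "(\<Sum>i\<in>S. int (Poly_Mapping.lookup (lift_exponent k) i)) =
      (\<Sum>i\<in>S. int (Poly_Mapping.lookup (lift_exponent 0) i) + (if k = 0 then 0 else w k i))"
    using assms S_subset by (intro sum.cong) (auto simp: lookup_lift_exponent lift_def)
  then have "int (weighted_degree b (lift_exponent k)) = int (weighted_degree b (lift_exponent 0))"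
    unfolding weighted_degree_membership[OF keys_lift_exponent]
    using sum_w[of k] assms by (cases "k = 0") (simp_all add: sum.distrib)
  then show "weighted_degree b (lift_exponent k) = weighted_degree b (lift_exponent 0)"
    by (simp only: of_nat_eq_iff)
qed

text \<open>
  Pulling \<open>z_k\<close> back along the chart gives \<open>y_k / y_0\<close>, because the functionals \<open>c\<close> are dual to
  the vectors \<open>w\<close>.
\<close>

lemma image_lift_exponent:
  assumes k: "k \<le> n"
  shows "image_exponent (lift_exponent k) + Poly_Mapping.single 0 1 =
    image_exponent (lift_exponent 0) + Poly_Mapping.single k 1"
proof (rule poly_mapping_eqI)
  fix l
  show "Poly_Mapping.lookup (image_exponent (lift_exponent k) + Poly_Mapping.single 0 1) l =
    Poly_Mapping.lookup (image_exponent (lift_exponent 0) + Poly_Mapping.single k 1) l"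
  proof (cases "l \<le> n")
    case l: True
    have "(\<Sum>i<n+2. c_hom l i * w k i) = (if k = l then 1 else 0) - (if l = 0 then 1 else 0)"
      if "k \<noteq> 0"
    proof (cases "l = 0")
      case True
      have "(\<Sum>i<n+2. c_hom 0 i * w k i) = - (\<Sum>l\<in>{1..n}. \<Sum>i<n+2. c l i * w k i)"
        unfolding sum.swap[of "\<lambda>l i. c l i * w k i" "{..<n+2}" "{1..n}"]
        by (simp add: c_hom_def sum_distrib_right sum_negf del: sum.lessThan_Suc)
      also have "(\<Sum>l\<in>{1..n}. \<Sum>i<n+2. c l i * w k i) = (\<Sum>l\<in>{1..n}. if k = l then 1 else 0)"
        using that k by (intro sum.cong refl c_w) auto
      also have "\<dots> = 1" using that k by simp
      finally show ?thesis using True that by simp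
    next
      case False
      then show ?thesis using c_w[of k l] that k l by (simp add: c_hom_def del: sum.lessThan_Suc)
    qed
    then have "int (Poly_Mapping.lookup (image_exponent (lift_exponent k)) l)
        + (if l = 0 then 1 else 0) =
        int (Poly_Mapping.lookup (image_exponent (lift_exponent 0)) l) + (if k = l then 1 else 0)"
      unfolding int_lookup_image_exponent[OF keys_lift_exponent l] weighted_degree_lift[OF k]
      using sum_lift_exponent[OF k, of "c_hom l"]
      by (cases "k = 0") (simp_all del: sum.lessThan_Suc)
    then show ?thesis
      by (simp add: lookup_add lookup_single when_def split: if_splits)
  next
    case False
    then show ?thesis
      using k lookup_image_exponent[OF keys_lift_exponent]
      by (simp add: lookup_add lookup_single when_def)
  qed
qed

definition chart_inverse :: "nat \<Rightarrow> 'k::field mpoly" where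
  "chart_inverse k = Poly_Mapping.single (lift_exponent k) 1"

lemma polys_chart_inverse: "chart_inverse k \<in> polys (n + 2)"
  unfolding chart_inverse_def by (rule polys_single[OF keys_lift_exponent])

lemma chart_inverse_homogeneous:
  assumes "k \<le> n"
  shows "weighted_homogeneous a (weighted_degree a (lift_exponent 0)) (chart_inverse k)"
    and "weighted_homogeneous b (weighted_degree b (lift_exponent 0)) (chart_inverse k)"
  using weighted_degree_lift[OF assms] by (simp_all add: weighted_homogeneous_def chart_inverse_def)

lemma chart_chart_inverse:
  assumes "k \<le> n"
  shows "Var 0 * subst chart (chart_inverse k) = subst chart (chart_inverse 0) * Var k"
  using image_lift_exponent[OF assms]
  by (simp add: chart_inverse_def subst_chart_single Var_def mult_single add.commute)

text \<open>
  The point whose coordinates in the chart are \<open>z_k = y_k / y_0\<close> and \<open>v = - A' / B'\<close>, where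
  \<open>x_i = chart i * v^(b i)\<close>. Scaling by \<open>B'\<close> with the weights \<open>a\<close> makes the coordinates
  polynomial, because \<open>b i \<le> 1 \<le> a i\<close>.
\<close>

definition parametrization :: "'k::field mpoly \<Rightarrow> 'k mpoly \<Rightarrow> nat \<Rightarrow> 'k mpoly" where
  "parametrization A' B' i = B' ^ (a i - b i) * ((- A') ^ b i * chart i)"

lemma b_le_a: "i < n + 2 \<Longrightarrow> b i \<le> a i"
  using weight_pos[of i] by (simp add: of_bool_def)

lemma weighted_degree_b_le_a:
  assumes "Poly_Mapping.keys u \<subseteq> {..<n + 2}"
  shows "weighted_degree b u \<le> weighted_degree a u"
  unfolding weighted_degree_superset[OF finite_lessThan assms]
  by (intro sum_mono mult_right_mono b_le_a) auto

lemma subst_parametrization: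
  assumes R: "R \<in> polys (n + 2)" "weighted_homogeneous a D R" "weighted_homogeneous b s R"
  shows "subst (parametrization A' B') R = B' ^ (D - s) * ((- A') ^ s * subst chart R)"
proof -
  have "weighted_degree (\<lambda>i. a i - b i) u = D - s" if u: "u \<in> Poly_Mapping.keys R" for u
  proof -
    have *: "Poly_Mapping.keys u \<subseteq> {..<n + 2}" using u R(1) by (simp add: polys_def)
    have "weighted_degree (\<lambda>i. a i - b i) u + weighted_degree b u = weighted_degree a u"
      unfolding weighted_degree_superset[OF finite_lessThan *] sum.distrib[symmetric]
        distrib_right[symmetric]
      using b_le_a by (intro sum.cong) simp_all
    then show ?thesis using u R by (simp add: weighted_homogeneous_def)
  qed
  then have "weighted_homogeneous (\<lambda>i. a i - b i) (D - s) R"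
    by (simp add: weighted_homogeneous_def)
  then have "subst (parametrization A' B') R = B' ^ (D - s) * subst (\<lambda>i. (- A') ^ b i * chart i) R"
    by (rule subst_scaled[OF R(1)]) (simp add: parametrization_def)
  also have "subst (\<lambda>i. (- A') ^ b i * chart i) R = (- A') ^ s * subst chart R"
    by (rule subst_scaled[OF R(1,3)]) simp
  finally show ?thesis .
qed

lemma polys_parametrization: "A' \<in> polys (n + 1) \<Longrightarrow> B' \<in> polys (n + 1) \<Longrightarrow>
    parametrization A' B' i \<in> polys (n + 1)"
  unfolding parametrization_def by (intro polys_closed(4,5) polys_power polys_chart)

lemma parametrization_homogeneous:
  assumes "weighted_homogeneous (\<lambda>_. 1) e A'" "weighted_homogeneous (\<lambda>_. 1) e B'" "i < n + 2"
  shows "weighted_homogeneous (\<lambda>_. 1) ((chart_degree + e) * a i) (parametrization A' B' i)"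
proof -
  have "weighted_homogeneous (\<lambda>_. 1) (e * (a i - b i) + (e * b i + chart_degree * a i))
      (parametrization A' B' i)"
    unfolding parametrization_def using assms
    by (intro homogeneous_mult homogeneous_power homogeneous_uminus chart_homogeneous)
  moreover have "e * (a i - b i) + (e * b i + chart_degree * a i) = (chart_degree + e) * a i"
    using b_le_a[OF assms(3)]
    by (simp only: add.assoc[symmetric] distrib_left[symmetric]
        distrib_right[symmetric] le_add_diff_inverse2) (simp add: algebra_simps)
  ultimately show ?thesis by simp
qed

end

section \<open>Hypersurfaces linear in a monomial coordinate\<close>

text \<open>
  The equation \<open>A + B = 0\<close> is linear in the coordinate \<open>v\<close> of degree 1 in \<open>S\<close>, and its solution is
  the parametrization. If \<open>A = 0\<close>, the solution \<open>v = 0\<close> lies outside the torus. This is admissible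
  if \<open>S\<close> has a single element \<open>i0\<close> and \<open>s = 0\<close>: then \<open>f\<close> is \<open>x_(i0)\<close> times a form without \<open>x_(i0)\<close>, and
  the parametrization has image in the coordinate hyperplane \<open>x_(i0) = 0\<close>, on which the \<open>z_k\<close> are
  still defined.
\<close>

lemma rational_if_linear_in_monomial_coordinate:
  fixes A B :: "'k::field mpoly"
  assumes pos: "\<And>i. i < n + 2 \<Longrightarrow> 0 < a i"
    and S: "S \<subseteq> {..<n + 2}" "i0 \<in> S"
    and gcd: "Gcd (a ` ({..<n + 2} - S)) = 1"
    and irr: "irreducible_set (hypersurface (n + 2) a (A + B))"
    and A: "A \<in> polys (n + 2)" "weighted_homogeneous a d A"
      "weighted_homogeneous (membership_weight S) s A"
    and B: "B \<in> polys (n + 2)" "weighted_homogeneous a d B"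
      "weighted_homogeneous (membership_weight S) (s + 1) B"
    and B_nonzero: "B \<noteq> 0"
    and A_nonzero: "A \<noteq> 0 \<or> S = {i0} \<and> s = 0"
  shows "rational_variety n (hypersurface (n + 2) a (A + B))"
proof -
  obtain c w :: "nat \<Rightarrow> nat \<Rightarrow> int" where
    w: "\<And>k. k \<in> {1..n} \<Longrightarrow> (\<Sum>i<n+2. int (a i) * w k i) = 0 \<and> (\<Sum>i\<in>S. w k i) = 0 \<and>
       (\<forall>l \<in> {1..n}. (\<Sum>i<n+2. c l i * w k i) = (if k = l then 1 else 0))"
    and c: "\<forall>\<alpha>. (\<forall>l \<in> {1..n}. (\<Sum>i<n+2. c l i * \<alpha> i) = 0) \<longrightarrow> (\<Sum>i<n+2. int (a i) * \<alpha> i) = 0 \<longrightarrow>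
       (\<Sum>i\<in>S. \<alpha> i) = 0 \<longrightarrow> (\<forall>i<n+2. \<alpha> i = 0)"
    using bigraded_basis_exists[OF S pos gcd] by blast
  interpret torus_chart n a S c w
    by unfold_locales (use pos S w c in blast)+
  let ?f = "A + B"
  let ?X = "hypersurface (n + 2) a ?f"
  let ?I = "vanishing_ideal ?X"
  define A' B' where "A' = subst chart A" and "B' = subst chart B"
  let ?\<psi> = "parametrization A' B'"
  have X [simp]: "ncoords ?X = n + 2" "weight ?X = a" by (simp_all add: hypersurface_def)
  have f: "?f \<in> polys (n + 2)" "weighted_homogeneous a d ?f"
    using A B by (auto intro: polys_closed homogeneous_add)
  have AB'_polys: "A' \<in> polys (n + 1)" "B' \<in> polys (n + 1)"
    unfolding A'_def B'_def using A B by (auto intro!: polys_subst polys_chart[simplified])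
  have AB'_wh: "weighted_homogeneous (\<lambda>_. 1) (chart_degree * d) A'"
      "weighted_homogeneous (\<lambda>_. 1) (chart_degree * d) B'"
    unfolding A'_def B'_def
    by (rule homogeneous_subst[OF A(1,2) chart_homogeneous]
        homogeneous_subst[OF B(1,2) chart_homogeneous], assumption)+
  have B'_nonzero: "B' \<noteq> 0"
    unfolding B'_def using B B_nonzero by (rule subst_chart_nonzero)
  have A'_nonzero: "A' \<noteq> 0" if "A \<noteq> 0"
    unfolding A'_def using A that by (rule subst_chart_nonzero)
  have \<psi>_nonzero_on: "subst ?\<psi> R \<noteq> 0"
    if "R \<in> polys (n + 2)" "weighted_homogeneous a D R" "weighted_homogeneous b t R"
      "R \<noteq> 0" "A \<noteq> 0 \<or> t = 0" for R D t
    using subst_chart_nonzero[OF that(1-4)] subst_parametrization[OF that(1-3)]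
        B'_nonzero A'_nonzero that(5)
    by auto

  have "Poly_Mapping.keys B \<noteq> {}"
    using B_nonzero by (metis poly_mapping_eqI not_in_keys_iff_lookup_eq_zero lookup_zero empty_iff)
  then obtain u where u: "u \<in> Poly_Mapping.keys B" by blast
  then have "s + 1 \<le> d"
    using weighted_degree_b_le_a[of u] B by (simp add: weighted_homogeneous_def polys_def)
  then have "B' ^ (d - s) = B' * B' ^ (d - (s + 1))"
    by (metis Suc_diff_Suc Suc_eq_plus1 Suc_le_eq power_Suc)
  then have \<psi>_f: "subst ?\<psi> ?f = 0"
    unfolding subst_add subst_parametrization[OF A] subst_parametrization[OF B]
    by (simp add: A'_def[symmetric] B'_def[symmetric] algebra_simps)

  have \<psi>_polys: "?\<psi> i \<in> polys (n + 1)" for i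
    using AB'_polys by (rule polys_parametrization)
  let ?e = "chart_degree + chart_degree * d"
  have \<psi>_wh: "weighted_homogeneous (\<lambda>_. 1) (?e * a i) (?\<psi> i)" if "i < n + 2" for i
    using AB'_wh that by (rule parametrization_homogeneous)
  have "{..<n + 2} - S \<noteq> {}"
  proof
    assume "{..<n + 2} - S = {}"
    then show False using gcd by (simp only: image_empty Gcd_empty)
  qed
  then obtain t where t: "t < n + 2" "t \<notin> S" by blast
  have "?\<psi> t \<noteq> 0"
    using t B'_nonzero by (simp add: parametrization_def chart_def single_nonzero)
  then have \<psi>_nonzero: "\<exists>i<n + 2. ?\<psi> i \<noteq> 0" using t by blast

  \<comment> \<open>The image of \<open>\<psi>\<close> is a point of \<open>X\<close>, so the forms that vanish on \<open>X\<close> vanish on \<open>\<psi>\<close>.\<close>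
  have "{F \<in> polys (n + 2). subst ?\<psi> F = 0} \<in> Proj (n + 2) a"
    using chart_degree_pos by (intro kernel_in_Proj[OF _ \<psi>_wh \<psi>_nonzero]) simp
  then have vanish: "subst ?\<psi> F = 0" if "F \<in> ?I" for F
    using that f \<psi>_f by (auto simp: vanishing_ideal_hypersurface)
  have f_I: "?f \<in> ?I" using f by (intro vanishing_ideal_closed)

  have generic: "F \<in> ?I"
    if F: "F \<in> polys (n + 2)" "weighted_homogeneous a D F" "subst ?\<psi> F = 0" for F D
  proof (cases "A = 0")
    case False
    have B_notin: "B \<notin> ?I" using vanish[of B] \<psi>_nonzero_on[OF B B_nonzero] False by blast
    have "F \<in> ?I"
      if "F \<in> polys (n + 2)" "weighted_homogeneous a D F" "subst ?\<psi> F = 0"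
        "\<And>u. u \<in> Poly_Mapping.keys F \<Longrightarrow> t \<le> weighted_degree b u \<and> weighted_degree b u \<le> t + r"
      for F D t r
      using that
    \<comment> \<open>Induction on the length \<open>r\<close> of an interval that contains the degrees of \<open>F\<close> in \<open>S\<close>;
        for \<open>r = 0\<close> the form is bihomogeneous.\<close>
    proof (induction r arbitrary: F D t)
      case 0
      then have "weighted_homogeneous b t F" by (force simp: weighted_homogeneous_def)
      then have "F = 0" using \<psi>_nonzero_on[of F D t] 0 False by blast
      then show ?case by (simp add: vanishing_ideal_closed)
    next
      case (Suc r)
      define T where "T = homogeneous_component b (t + Suc r) F"
      \<comment> \<open>The top component \<open>T\<close> is eliminated by \<open>B T = - A T\<close> modulo \<open>f\<close>, which lowers its
          degree by 1 relative to the other components of \<open>B F\<close>.\<close>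
      define G where "G = B * F - ?f * T"
      have T: "T \<in> polys (n + 2)" "weighted_homogeneous a D T"
          "weighted_homogeneous b (t + Suc r) T"
        using Suc.prems by (auto simp: T_def polys_component
            homogeneous_component_homogeneous bihomogeneous_component)
      have G: "G = B * (F - T) - A * T" by (simp add: G_def algebra_simps)
      have "G \<in> ?I"
      proof (rule Suc.IH)
        show "G \<in> polys (n + 2)"
          unfolding G_def using T Suc.prems B f by (intro polys_diff polys_closed(5))
        show "weighted_homogeneous a (d + D) G"
          unfolding G_def using T Suc.prems B f by (intro homogeneous_diff homogeneous_mult)
        show "subst ?\<psi> G = 0"
          unfolding G_def subst_diff subst_mult using Suc.prems \<psi>_f by simp
        fix u assume "u \<in> Poly_Mapping.keys G"
        then consider "u \<in> Poly_Mapping.keys (B * (F - T))" | "u \<in> Poly_Mapping.keys (A * T)"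
          unfolding G using keys_diff[of "B * (F - T)" "A * T"] by blast
        then show "t + s + 1 \<le> weighted_degree b u \<and> weighted_degree b u \<le> t + s + 1 + r"
        proof cases
          case 1
          then obtain v v' where v: "u = v + v'" "v \<in> Poly_Mapping.keys B"
              "v' \<in> Poly_Mapping.keys (F - T)"
            using keys_mult[of B "F - T"] by blast
          have "v' \<in> Poly_Mapping.keys F" "weighted_degree b v' \<noteq> t + Suc r"
            using v(3) by (auto simp: in_keys_iff lookup_minus T_def lookup_homogeneous_component
                split: if_splits)
          with Suc.prems(4)[of v'] v B(3) show ?thesis
            by (simp add: weighted_homogeneous_def weighted_degree_add)
        next
          case 2
          then obtain v v' where v: "u = v + v'" "v \<in> Poly_Mapping.keys A"
              "v' \<in> Poly_Mapping.keys T"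
            using keys_mult[of A T] by blast
          with T(3) A(3) show ?thesis
            by (simp add: weighted_homogeneous_def weighted_degree_add)
        qed
      qed
      moreover have "B * F = G + T * ?f" by (simp add: G_def algebra_simps)
      ultimately have "B * F \<in> ?I"
        using f_I T(1) by (simp add: vanishing_ideal_closed)
      then have "B \<in> ?I \<or> F \<in> ?I"
        using irr B Suc.prems by (intro vanishing_ideal_prime) auto
      then show ?case using B_notin by blast
    qed
    from this[OF F, of 0 D] show ?thesis
      using F weighted_degree_b_le_a by (force simp: polys_def weighted_homogeneous_def)
  next
    case True
    then have S0: "S = {i0}" "s = 0" using A_nonzero by auto
    have wd: "weighted_degree b u = Poly_Mapping.lookup u i0"
        if "Poly_Mapping.keys u \<subseteq> {..<n + 2}" for u
      using weighted_degree_membership[OF that] S0 by simp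
    have "Poly_Mapping.lookup u i0 \<noteq> 0" if "u \<in> Poly_Mapping.keys B" for u
      using wd[of u] that B S0 by (simp add: weighted_homogeneous_def polys_def)
    then obtain l where l: "B = Var i0 * l" "\<And>N. B \<in> polys N \<Longrightarrow> l \<in> polys N"
      "\<And>v D. weighted_homogeneous v D B \<Longrightarrow> weighted_homogeneous v (D - v i0) l"
      by (rule divide_by_Var) auto
    have l': "l \<in> polys (n + 2)" "weighted_homogeneous a (d - a i0) l" "weighted_homogeneous b 0 l"
      "l \<noteq> 0"
      using l(2)[OF B(1)] l(3)[OF B(2)] l(3)[OF B(3)] S0 l(1) B_nonzero by auto
    have "l \<notin> ?I" using vanish \<psi>_nonzero_on[OF l'] by blast
    moreover have "Var i0 * l \<in> ?I" using f_I l(1) True by simp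
    \<comment> \<open>Here \<open>f = x_(i0) l\<close>, and \<open>l\<close> does not vanish on the hyperplane parametrized by \<open>\<psi>\<close>.\<close>
    ultimately have x: "Var i0 \<in> ?I"
      using vanishing_ideal_prime[OF irr polys_Var homogeneous_Var l'(1,2)] S by blast
    define F0 where "F0 = homogeneous_component b 0 F"
    have F0: "F0 \<in> polys (n + 2)" "weighted_homogeneous a D F0" "weighted_homogeneous b 0 F0"
      using F by (auto simp: F0_def polys_component
          homogeneous_component_homogeneous bihomogeneous_component)
    have "Poly_Mapping.lookup u i0 \<noteq> 0" if "u \<in> Poly_Mapping.keys (F - F0)" for u
    proof -
      have "u \<in> Poly_Mapping.keys F" "weighted_degree b u \<noteq> 0"
        using that by (auto simp: in_keys_iff lookup_minus F0_def lookup_homogeneous_component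
            split: if_splits)
      then show ?thesis using wd[of u] F(1) by (simp add: polys_def)
    qed
    then obtain q where q: "F - F0 = Var i0 * q" "\<And>N. F - F0 \<in> polys N \<Longrightarrow> q \<in> polys N"
      by (rule divide_by_Var) auto
    have "q * Var i0 \<in> ?I"
      using x q(2)[OF polys_diff[OF F(1) F0(1)]] by (intro vanishing_ideal_closed)
    then have D: "F - F0 \<in> ?I" using q(1) by (simp add: mult.commute)
    then have "subst ?\<psi> F0 = 0" using vanish[OF D] F(3) by (simp add: subst_diff)
    then have "F0 = 0" using \<psi>_nonzero_on[OF F0] by blast
    then show ?thesis using D by simp
  qed

  let ?\<phi> = "chart_inverse :: nat \<Rightarrow> 'k mpoly"
  have \<psi>_\<phi>: "\<exists>K. K \<noteq> 0 \<and> (\<forall>j\<le>n. subst ?\<psi> (?\<phi> j) = K * subst chart (?\<phi> j))"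
  proof -
    let ?D = "weighted_degree a (lift_exponent 0)" and ?s = "weighted_degree b (lift_exponent 0)"
    have "?s = 0" if "S = {i0}"
    proof -
      have "w k i0 = 0" if "k \<in> {1..n}" for k using sum_w[OF that] \<open>S = {i0}\<close> by simp
      then have "lift 0 i0 = 0" by (simp add: lift_def)
      then show ?thesis
        using weighted_degree_membership[OF keys_lift_exponent, of 0]
          lookup_lift_exponent[of i0 0] that S by simp
    qed
    then have "B' ^ (?D - ?s) * (- A') ^ ?s \<noteq> 0"
      using B'_nonzero A'_nonzero A_nonzero by auto
    moreover have "subst ?\<psi> (?\<phi> j) = B' ^ (?D - ?s) * (- A') ^ ?s * subst chart (?\<phi> j)"
        if "j \<le> n" for j
      using subst_parametrization[OF polys_chart_inverse chart_inverse_homogeneous[OF that]]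
      by (simp add: mult.assoc)
    ultimately show ?thesis by blast
  qed
  then obtain K where K: "K \<noteq> 0" "\<And>j. j \<le> n \<Longrightarrow> subst ?\<psi> (?\<phi> j) = K * subst chart (?\<phi> j)"
    by blast
  show ?thesis
  proof (rule rational_variety_criterion[of ?X ?\<psi> n ?e ?\<phi> "weighted_degree a (lift_exponent 0)"])
    show "Var 0 * subst ?\<psi> (?\<phi> j) = subst ?\<psi> (?\<phi> 0) * Var j" if "j \<le> n" for j
      using chart_chart_inverse[OF that, where 'a = 'k] K that
          by (simp add: mult.assoc mult.left_commute[of _ K])
    show "subst ?\<psi> (?\<phi> 0) \<noteq> 0"
      using K by (simp add: chart_inverse_def subst_chart_single single_nonzero)
  qed (unfold X, (use \<psi>_polys \<psi>_wh \<psi>_nonzero vanish generic polys_chart_inverse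
      chart_inverse_homogeneous in blast)+)
qed

section \<open>Equations of degree one and two\<close>

lemma degree_in_eq_weighted_degree:
  assumes "finite S"
  shows "degree_in S u = weighted_degree (membership_weight S) u"
proof -
  have "weighted_degree (membership_weight S) u =
      (\<Sum>i\<in>Poly_Mapping.keys u \<union> S. of_bool (i \<in> S) * Poly_Mapping.lookup u i)"
    using assms by (intro weighted_degree_superset) auto
  also have "\<dots> = (\<Sum>i\<in>Poly_Mapping.keys u \<union> S. if i \<in> S then Poly_Mapping.lookup u i else 0)"
    by (intro sum.cong refl) simp
  also have "\<dots> = (\<Sum>i\<in>S. Poly_Mapping.lookup u i)"
  proof -
    have "(Poly_Mapping.keys u \<union> S) \<inter> S = S" by blast
    then show ?thesis using assms by (simp flip: sum.inter_restrict)
  qed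
  finally show ?thesis by (simp add: degree_in_def)
qed

lemma sum_of_two_components:
  assumes "\<And>u. u \<in> Poly_Mapping.keys p \<Longrightarrow> weighted_degree v u \<in> {s, s + 1}"
  shows "homogeneous_component v s p + homogeneous_component v (s + 1) p = p"
proof (rule poly_mapping_eqI)
  fix u
  show "Poly_Mapping.lookup (homogeneous_component v s p + homogeneous_component v (s + 1) p) u =
      Poly_Mapping.lookup p u"
    using assms[of u] by (cases "u \<in> Poly_Mapping.keys p")
      (auto simp: lookup_add lookup_homogeneous_component in_keys_iff)
qed

theorem theorem3p3:
  fixes f :: "'k::field mpoly" and a :: "nat \<Rightarrow> nat" and n m d :: nat
  assumes weights_pos: "\<And>i. i \<le> n + 1 \<Longrightarrow> 0 < a i"
    and f_poly: "f \<in> polys (n + 2)" and f_nonzero: "f \<noteq> 0"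
    and f_homogeneous: "weighted_homogeneous a d f"
    and X_irreducible: "irreducible_set (hypersurface (n + 2) a f)"
    and m_range: "1 \<le> m" "m \<le> n - 1"
    and gcd_weights: "Gcd (a ` {0..m}) = 1"
    and weights_well_formed: "well_formed {m + 1..n + 1} a"
    and f_degrees: "\<And>u. u \<in> Poly_Mapping.keys f \<Longrightarrow> degree_in {0..m} u \<in> {1, 2}"
    and f_degree_one: "\<exists>u \<in> Poly_Mapping.keys f. degree_in {0..m} u = 1"
  shows "rational_variety n (hypersurface (n + 2) a f)"
proof -
  have rational: "rational_variety n (hypersurface (n + 2) a f)"
    if S: "S \<subseteq> {0..m}" "i \<in> S"
      and deg: "\<And>u. u \<in> Poly_Mapping.keys f \<Longrightarrow> degree_in S u \<in> {s, s + 1}"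
      and top: "\<exists>u \<in> Poly_Mapping.keys f. degree_in S u = s + 1"
      and bot: "(\<exists>u \<in> Poly_Mapping.keys f. degree_in S u = s) \<or> S = {i} \<and> s = 0"
    for S i s
  proof -
    let ?b = "membership_weight S"
    have fin: "finite S" using S(1) by (rule finite_subset) simp
    note deg_b = degree_in_eq_weighted_degree[OF fin]
    have f_split: "homogeneous_component ?b s f + homogeneous_component ?b (s + 1) f = f"
      using deg unfolding deg_b by (rule sum_of_two_components)
    have nonzero: "homogeneous_component ?b t f \<noteq> 0"
      if "\<exists>u \<in> Poly_Mapping.keys f. degree_in S u = t" for t
    proof -
      have "Poly_Mapping.keys (homogeneous_component ?b t f) \<noteq> {}"
        using that by (auto simp: keys_homogeneous_component deg_b)
      then show ?thesis by auto
    qed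
    have "Gcd (a ` ({m + 1..n + 1} - {m + 1})) = 1"
      using weights_well_formed m_range by (simp add: well_formed_def)
    moreover have "a ` ({m + 1..n + 1} - {m + 1}) \<subseteq> a ` ({..<n + 2} - S)"
      using S(1) by (intro image_mono) auto
    then have "Gcd (a ` ({..<n + 2} - S)) dvd Gcd (a ` ({m + 1..n + 1} - {m + 1}))"
      by (intro Gcd_greatest Gcd_dvd) blast
    ultimately have gcd: "Gcd (a ` ({..<n + 2} - S)) = 1" by simp
    have "rational_variety n (hypersurface (n + 2) a
        (homogeneous_component ?b s f + homogeneous_component ?b (s + 1) f))"
    proof (rule rational_if_linear_in_monomial_coordinate[OF _ _ S(2) gcd, where d = d])
      show "S \<subseteq> {..<n + 2}" using S(1) m_range by auto
      show "irreducible_set (hypersurface (n + 2) a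
          (homogeneous_component ?b s f + homogeneous_component ?b (s + 1) f))"
        using X_irreducible by (simp only: f_split)
      show "homogeneous_component ?b s f \<noteq> 0 \<or> S = {i} \<and> s = 0" using nonzero bot by blast
    qed (use weights_pos f_poly f_homogeneous nonzero top in
        \<open>simp_all add: polys_component homogeneous_component_homogeneous bihomogeneous_component\<close>)
    then show ?thesis by (simp only: f_split)
  qed
  show ?thesis
  proof (cases "\<exists>u \<in> Poly_Mapping.keys f. degree_in {0..m} u = 2")
    case True
    then show ?thesis
      using f_degrees f_degree_one by (intro rational[of "{0..m}" 0 1]) (auto simp: numeral_2_eq_2)
  next
    case False
    then have deg1: "degree_in {0..m} u = 1" if "u \<in> Poly_Mapping.keys f" for u
      using f_degrees[OF that] that by auto
    obtain u where u: "u \<in> Poly_Mapping.keys f" using f_degree_one by blast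
    have "(\<Sum>i\<in>{0..m}. Poly_Mapping.lookup u i) \<noteq> 0"
      using deg1[OF u] by (simp add: degree_in_def)
    then obtain i where i: "i \<le> m" "Poly_Mapping.lookup u i \<noteq> 0"
      by (metis atLeastAtMost_iff sum.neutral)
    have le: "Poly_Mapping.lookup v i \<le> 1" if "v \<in> Poly_Mapping.keys f" for v
      unfolding deg1[OF that, symmetric] degree_in_def using i by (intro member_le_sum) auto
    have "degree_in {i} v = Poly_Mapping.lookup v i" for v by (simp add: degree_in_def)
    then show ?thesis
      using u i le by (intro rational[of "{i}" i 0]) (force simp: le_Suc_eq)+
  qed
qed

end
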